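(* The 0-cycle of limit Weierstrass points on the fiber $X^4=0$ over $t=0$ of the family of plane quartics $F(X,Y,Z,t)=0$ over $\mathbb{C}$ is $22(0:0:1)+2(0:-1:1)$.
   Context: Work over $\mathbb{C}$, with homogeneous coordinates $(X:Y:Z)$ on $\mathbb{P}^2$. Put $$\begin{aligned}G(X,Y,Z)=\;&X^4 -3X^3Y +6X^3Z -3X^2Y^2 -6X^2YZ +6X^2Z^2 +4XY^3\\&-6XY^2Z -6XYZ^2 +XZ^3 +3Y^4 +3Y^3Z,\end{aligned}$$ $$F(X,Y,Z,t)=X^4+t\,G(X,Y,Z).$$ Limit Weierstrass points over $t=0$: let $B=\operatorname{Spec}\mathbb{C}[t]$ and $B^*=\operatorname{Spec}\mathbb{C}[t,t^{-1}]$, and let $\mathcal{W}\subset\mathbb{P}^2_B$ be the scheme of flexes of the family, i.e. the closed subscheme defined by $F$ and its Hessian determinant with respect to $X,Y,Z$. Let $\mathcal{W}^*$ be the inverse image of $B^*$ in $\mathcal{W}$; it is finite and flat over $B^*$, its fiber over a nonzero $t$ consisting of the 24 flexes (with multiplicity) of the curve $F(X,Y,Z,t)=0$ (for smooth fibers these are the Weierstrass points counted with weight). Let $\mathcal{W}'$ be the closure of $\mathcal{W}^*$ in $\mathbb{P}^2_B$, which is flat over $B$, and let $W'_0$ be its fiber over $t=0$, a zero-dimensional scheme of degree 24. The 0-cycle of limit Weierstrass points on the fiber over $t=0$ is the 0-cycle of $\mathbb{P}^2$ associated to $W'_0$, i.e. the sum of the points of its support, each with coefficient the multiplicity (length) of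 $W'_0$ at that point. *)

theory Defs
  imports
    "HOL-Analysis.Analysis"
    "HOL-Computational_Algebra.Computational_Algebra"
    "HOL-Library.Poly_Mapping"
    "HOL-Library.Extended_Nat"
    "HOL-Algebra.Algebraic_Closure_Type"
begin

section \<open>Polynomials in three variables\<close>

text \<open>
  The variables \<open>X, Y, Z\<close> are indexed by the type \<^typ>\<open>3\<close>, as are the coordinates of
  vectors in \<^typ>\<open>complex^3\<close>. Polynomials over \<open>\<complex>[t]\<close> have \<open>'a = complex poly\<close>; degrees and
  derivatives never involve \<open>t\<close>.
\<close>

type_synonym 'a poly3 = "(3 \<Rightarrow>\<^sub>0 nat) \<Rightarrow>\<^sub>0 'a"

definition coeff_const :: "'a::zero \<Rightarrow> 'a poly3" where
  "coeff_const c = Poly_Mapping.single 0 c"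

definition hvar :: "3 \<Rightarrow> 'a::comm_ring_1 poly3" where
  "hvar i = Poly_Mapping.single (Poly_Mapping.single i 1) 1"

definition eval3 :: "'a::comm_ring_1 ^ 3 \<Rightarrow> 'a poly3 \<Rightarrow> 'a" where
  "eval3 v f =
     (\<Sum>m\<in>Poly_Mapping.keys f.
        Poly_Mapping.lookup f m * (\<Prod>i\<in>UNIV. (v $ i) ^ Poly_Mapping.lookup m i))"

definition homogeneous3 :: "nat \<Rightarrow> 'a::zero poly3 \<Rightarrow> bool" where
  "homogeneous3 d f \<longleftrightarrow>
     (\<forall>m\<in>Poly_Mapping.keys f. (\<Sum>i\<in>UNIV. Poly_Mapping.lookup m i) = d)"

definition pderiv3 :: "3 \<Rightarrow> 'a::comm_ring_1 poly3 \<Rightarrow> 'a poly3" where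
  "pderiv3 i f =
     (\<Sum>m\<in>Poly_Mapping.keys f.
        Poly_Mapping.single (m - Poly_Mapping.single i 1)
          (of_nat (Poly_Mapping.lookup m i) * Poly_Mapping.lookup f m))"

definition hessian :: "'a::comm_ring_1 poly3 \<Rightarrow> 'a poly3" where
  "hessian f = det (\<chi> i j. pderiv3 i (pderiv3 j f))"

definition poly3_ring :: "'a::comm_ring_1 set \<Rightarrow> 'a poly3 ring" where
  "poly3_ring A = ring_of_type_algebra \<lparr>carrier := {f. \<forall>m. Poly_Mapping.lookup f m \<in> A}\<rparr>"


section \<open>Points and local rings of the projective plane\<close>

definition proportional :: "complex^3 \<Rightarrow> complex^3 \<Rightarrow> bool" where
  "proportional u v \<longleftrightarrow> u \<noteq> 0 \<and> v \<noteq> 0 \<and> (\<exists>c. v = c *s u)"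

quotient_type proj_plane = "complex^3" / partial: proportional
proof (rule part_equivpI)
  have "proportional (axis 1 1) (axis 1 1)"
    unfolding proportional_def by (auto simp: axis_eq_0_iff intro: exI[of _ 1])
  then show "\<exists>v. proportional v v" ..
next
  show "symp proportional"
  proof (rule sympI)
    fix u v assume "proportional u v"
    then obtain c where uv: "u \<noteq> 0" "v \<noteq> 0" "v = c *s u" unfolding proportional_def by blast
    then have "u = inverse c *s v" by (auto simp: vector_smult_assoc)
    with uv show "proportional v u" unfolding proportional_def by blast
  qed
next
  show "transp proportional"
    unfolding transp_def proportional_def by (metis vector_smult_assoc)
qed

text \<open>\<open>hpoint a b c\<close> is the point \<open>(a:b:c)\<close>; it is meaningful only for \<open>(a, b, c) \<noteq> 0\<close>.\<close>

definition hpoint :: "complex \<Rightarrow> complex \<Rightarrow> complex \<Rightarrow> proj_plane" where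
  "hpoint a b c = abs_proj_plane (vector [a, b, c])"

lemma eval3_scale:
  fixes g :: "'a::comm_ring_1 poly3"
  assumes "homogeneous3 d g"
  shows "eval3 (c *s v) g = c ^ d * eval3 v g"
proof -
  have "(\<Prod>i\<in>UNIV. ((c *s v) $ i) ^ Poly_Mapping.lookup m i)
      = c ^ d * (\<Prod>i\<in>UNIV. (v $ i) ^ Poly_Mapping.lookup m i)"
    if "m \<in> Poly_Mapping.keys g" for m
    using assms that
    by (simp add: homogeneous3_def power_mult_distrib prod.distrib flip: power_sum)
  then show ?thesis
    unfolding eval3_def sum_distrib_left by (intro sum.cong) (simp_all add: mult_ac)
qed

lemma proportional_eval3_iff:
  assumes "proportional u v" "homogeneous3 d g"
  shows "eval3 u g = 0 \<longleftrightarrow> eval3 v g = 0"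
proof -
  obtain c where c: "v = c *s u" "v \<noteq> 0" using assms(1) unfolding proportional_def by blast
  then have "c \<noteq> 0" by auto
  with c show ?thesis using eval3_scale[OF assms(2), of c u] by simp
qed

text \<open>
  The local ring of the plane at \<open>p\<close>: fractions of forms of the same degree whose denominator
  does not vanish at \<open>p\<close>. For a homogeneous ideal \<open>I\<close>, \<open>local_fractions I p\<close> is the
  ideal generated by \<open>I\<close> in this local ring.
\<close>

lift_definition local_fractions :: "complex poly3 set \<Rightarrow> proj_plane \<Rightarrow> complex poly3 fract set" is
  "\<lambda>I v. {Fraction_Field.Fract f g | f g d.
            f \<in> I \<and> homogeneous3 d f \<and> homogeneous3 d g \<and> eval3 v g \<noteq> 0}"
  using proportional_eval3_iff by blast

definition local_ring :: "proj_plane \<Rightarrow> complex poly3 fract ring" where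
  "local_ring p = ring_of_type_algebra \<lparr>carrier := local_fractions UNIV p\<rparr>"

text \<open>A closed subscheme of the plane is given by a homogeneous ideal.\<close>

definition subscheme_local_ring :: "complex poly3 set \<Rightarrow> proj_plane \<Rightarrow> complex poly3 fract set ring"
  where "subscheme_local_ring I p = local_ring p Quot local_fractions I p"

text \<open>The length of a commutative ring as a module over itself, whose submodules are the ideals.\<close>

definition ring_length :: "('a, 'b) ring_scheme \<Rightarrow> enat" where
  "ring_length R =
     (SUP n\<in>{n. \<exists>J. (\<forall>i\<le>n. ideal (J i) R) \<and> (\<forall>i<n. J i \<subset> J (Suc i))}. enat n)"

text \<open>
  \<open>has_zero_cycle I C\<close>: the subscheme given by \<open>I\<close> has finite length at every point, and
  \<open>C\<close> is its associated 0-cycle. Finiteness of the support is part of the type of \<open>C\<close>.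
\<close>

definition has_zero_cycle :: "complex poly3 set \<Rightarrow> (proj_plane \<Rightarrow>\<^sub>0 nat) \<Rightarrow> bool" where
  "has_zero_cycle I C \<longleftrightarrow>
     (\<forall>p. ring_length (subscheme_local_ring I p) = enat (Poly_Mapping.lookup C p))"

lemma has_zero_cycle_unique: "has_zero_cycle I C \<Longrightarrow> has_zero_cycle I D \<Longrightarrow> C = D"
  by (rule poly_mapping_eqI) (simp add: has_zero_cycle_def)


section \<open>The flex scheme of a family and its limit over \<open>t = 0\<close>\<close>

text \<open>
  Closed subschemes of the plane over a base ring \<open>A\<close> are given by homogeneous ideals of
  \<open>A[X, Y, Z]\<close>; inverse images under base change are given by extended ideals, and the
  scheme-theoretic closure of a closed subscheme over \<open>\<complex>[t, 1/t]\<close> is given by the contracted ideal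
  in \<open>\<complex>[t][X, Y, Z]\<close>.
\<close>

definition flex_ideal :: "complex poly poly3 \<Rightarrow> complex poly poly3 set" where
  "flex_ideal f = genideal (poly3_ring UNIV) {f, hessian f}"

definition laurent_ring :: "complex poly fract set" where
  "laurent_ring = {Fraction_Field.Fract p ([:0, 1:] ^ k) | p k. True}"

definition flex_ideal_punctured :: "complex poly poly3 \<Rightarrow> complex poly fract poly3 set" where
  "flex_ideal_punctured f =
     genideal (poly3_ring laurent_ring) (Poly_Mapping.map to_fract ` flex_ideal f)"

definition flex_ideal_closure :: "complex poly poly3 \<Rightarrow> complex poly poly3 set" where
  "flex_ideal_closure f = {g. Poly_Mapping.map to_fract g \<in> flex_ideal_punctured f}"

definition fiber0 :: "complex poly poly3 \<Rightarrow> complex poly3" where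
  "fiber0 = Poly_Mapping.map (\<lambda>c. poly c 0)"

definition limit_flex_ideal :: "complex poly poly3 \<Rightarrow> complex poly3 set" where
  "limit_flex_ideal f = genideal (poly3_ring UNIV) (fiber0 ` flex_ideal_closure f)"


section \<open>The family of quartics\<close>

definition quartic_G :: "complex poly poly3" where
  "quartic_G =
    (let x = hvar 1; y = hvar 2; z = hvar 3 in
       x^4 - 3*x^3*y + 6*x^3*z - 3*x^2*y^2 - 6*x^2*y*z + 6*x^2*z^2 + 4*x*y^3
       - 6*x*y^2*z - 6*x*y*z^2 + x*z^3 + 3*y^4 + 3*y^3*z)"

text \<open>The variable \<open>t\<close> is the constant polynomial with coefficient \<^term>\<open>[:0, 1:]\<close>.\<close>

definition quartic_F :: "complex poly poly3" where
  "quartic_F = hvar 1 ^ 4 + coeff_const [:0, 1:] * quartic_G"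

lemma hvar_power: "hvar i ^ n = Poly_Mapping.single (Poly_Mapping.single i n) 1"
  by (induction n) (simp_all add: hvar_def mult_single flip: single_add)

lemma fiber0_quartic_F: "fiber0 quartic_F = hvar 1 ^ 4"
proof (rule poly_mapping_eqI)
  fix m
  have "Poly_Mapping.lookup (coeff_const [:0, 1:] * quartic_G) m
      = [:0, 1:] * Poly_Mapping.lookup quartic_G m"
    by (simp add: coeff_const_def flip: mult_map_scale_conv_mult)
       (simp add: Poly_Mapping.map.rep_eq when_def)
  moreover have "Poly_Mapping.lookup (fiber0 f) m = poly (Poly_Mapping.lookup f m) 0" for f
    by (simp add: fiber0_def Poly_Mapping.map.rep_eq when_def)
  ultimately show "Poly_Mapping.lookup (fiber0 quartic_F) m = Poly_Mapping.lookup (hvar 1 ^ 4) m"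
    by (simp add: quartic_F_def lookup_add hvar_power lookup_single when_def)
qed

end

theory Submission
  imports Defs
begin

text \<open>
  Write \<open>D = G\<^sub>Y\<^sub>Y G\<^sub>Z\<^sub>Z - G\<^sub>Y\<^sub>Z\<^sup>2\<close> and \<open>E = Hess G\<close>. Then \<open>Hess F = t\<^sup>2 H\<close> with
  \<open>H = 12 X\<^sup>2 D + t E\<close>, and \<open>P = X\<^sup>2 E - 12 G D\<close> satisfies \<open>t P = X\<^sup>2 H - 12 D F\<close> and
  \<open>X\<^sup>2 P = E F - G H\<close>. Since \<open>X\<close> divides neither \<open>G\<close> nor \<open>D\<close>, every syzygy of the fibers
  \<open>X\<^sup>4, 12 X\<^sup>2 D, P\<close> of \<open>F, H, P\<close> over \<open>t = 0\<close> is a combination of the fibers of these two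
  relations and hence lifts. So \<open>(F, H, P)\<close> is saturated with respect to \<open>t\<close>: it is the ideal of the
  closure, and the limit scheme is given by \<open>(X\<^sup>4, X\<^sup>2 D, P)\<close>.

  Modulo \<open>X\<close> one has \<open>G = 3 Y\<^sup>3 (Y + Z)\<close> and \<open>D = -81 Y\<^sup>4\<close>. Multiplication by \<open>X\<^sup>2\<close> shows that
  the local length at a point of the line \<open>X = 0\<close> is \<open>2 ord(GD) + 2 ord(D)\<close>, the orders being those of
  the restrictions to this line: \<open>2 * 7 + 2 * 4\<close> at \<open>(0:0:1)\<close> and \<open>2 * 1 + 2 * 0\<close> at \<open>(0:-1:1)\<close>.
\<close>

section \<open>Lengths of quotient rings\<close>

text \<open>The naive fiber of the flex scheme over t = 0 is useless: \<open>X^4\<close> contributes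
  a single entry to the Hessian matrix, so Hess F is divisible by t^2 and that fiber is the whole
  quadruple line. Dividing by t^2 is not enough either, since \<open>X^4\<close> and
  \<open>X^2 D\<close> still vanish on the line X = 0. The missing equation comes from the obvious
  syzygy between these two: Q F and X^2 H agree over t = 0, where Q = 12 D, and their difference
  divided by t is P. On the line, P restricts to -12 G D, which is not identically zero, so the
  scheme becomes finite. The local formula is read off the filtration by powers of X. In the layers
  of X^0 and X^1 only P gives a condition, of order ord(GD). In the layers of X^2 and X^3 the
  generator \<open>X^2 D\<close> gives the stronger condition ord(D), because P is a multiple of D
  modulo X^2. Globally GD and D restrict to forms of degrees 8 and 4, and 2 * 8 + 2 * 4 = 24 is the
  expected number of flexes.\<close>

definition ideal_chain :: "nat \<Rightarrow> ('a, 'b) ring_scheme \<Rightarrow> 'a set \<Rightarrow> bool" where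
  "ideal_chain n R I \<longleftrightarrow>
     (\<exists>J. (\<forall>i\<le>n. ideal (J i) R \<and> I \<subseteq> J i) \<and> (\<forall>i<n. J i \<subset> J (Suc i)))"

lemma (in ideal) rcos_eq_iff:
  assumes "a \<in> carrier R" "b \<in> carrier R"
  shows "I +> a = I +> b \<longleftrightarrow> a \<ominus> b \<in> I"
proof -
  have "a \<ominus> b \<in> I \<longleftrightarrow> a \<in> I +> b"
    using a_rcos_module_minus[OF ring_axioms assms(2,1)] by simp
  then show ?thesis
    using a_repr_independence[OF _ assms(2) a_subgroup] a_rcos_self[OF assms(1)] by metis
qed

lemma carrier_Quot: "carrier (R Quot I) = (\<lambda>a. I +>\<^bsub>R\<^esub> a) ` carrier R"
  unfolding FactRing_def A_RCOSETS_def' by auto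

lemma (in ideal) ideal_Quot_image:
  assumes "ideal J R" "I \<subseteq> J"
  shows "ideal ((\<lambda>a. I +> a) ` J) (R Quot I)"
proof -
  interpret J: ideal J R by fact
  interpret h: ring_hom_ring R "R Quot I" "(+>) I" by (rule rcos_ring_hom_ring)
  show ?thesis
  proof (intro idealI quotient_is_ring)
    show "subgroup ((+>) I ` J) (add_monoid (R Quot I))"
    proof (rule group.subgroupI)
      show "group (add_monoid (R Quot I))" using h.S.a_group .
      show "(+>) I ` J \<subseteq> carrier (add_monoid (R Quot I))" by (auto intro: J.a_Hcarr)
      show "(+>) I ` J \<noteq> {}" using J.zero_closed by blast
      show "inv\<^bsub>add_monoid (R Quot I)\<^esub> a \<in> (+>) I ` J" if "a \<in> (+>) I ` J" for a
      proof -
        obtain b where b: "b \<in> J" "a = I +> b" using \<open>a \<in> (+>) I ` J\<close> by blast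
        then have "inv\<^bsub>add_monoid (R Quot I)\<^esub> a = I +> (\<ominus> b)"
          using h.hom_a_inv[OF J.a_Hcarr] unfolding a_inv_def by simp
        with b show ?thesis using J.a_inv_closed by blast
      qed
      show "a \<otimes>\<^bsub>add_monoid (R Quot I)\<^esub> b \<in> (+>) I ` J"
        if "a \<in> (+>) I ` J" "b \<in> (+>) I ` J" for a b
        using that J.a_closed J.a_Hcarr by (auto simp flip: h.hom_add)
    qed
  next
    fix a x assume "a \<in> (+>) I ` J" "x \<in> carrier (R Quot I)"
    then obtain b y where "a = I +> b" "b \<in> J" "x = I +> y" "y \<in> carrier R"
      by (auto simp: carrier_Quot)
    then show "x \<otimes>\<^bsub>R Quot I\<^esub> a \<in> (+>) I ` J" "a \<otimes>\<^bsub>R Quot I\<^esub> x \<in> (+>) I ` J"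
      using J.I_l_closed J.I_r_closed J.a_Hcarr by (auto simp flip: h.hom_mult)
  qed
qed

lemma (in ideal) ideal_Quot_vimage:
  assumes "ideal J (R Quot I)"
  shows "ideal {a \<in> carrier R. I +> a \<in> J} R" "I \<subseteq> {a \<in> carrier R. I +> a \<in> J}"
proof -
  interpret J: ideal J "R Quot I" by fact
  interpret h: ring_hom_ring R "R Quot I" "(+>) I" by (rule rcos_ring_hom_ring)
  show "ideal {a \<in> carrier R. I +> a \<in> J} R"
    using h.ideal_vimage[OF assms] .
  show "I \<subseteq> {a \<in> carrier R. I +> a \<in> J}"
  proof
    fix a assume a: "a \<in> I"
    then have "I +> a = \<zero>\<^bsub>R Quot I\<^esub>"
      using a_rcos_const[OF a] by (simp only: FactRing_def ring.simps)
    then have "I +> a \<in> J" using additive_subgroup.zero_closed[OF J.additive_subgroup_axioms]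
      by (simp only:)
    then show "a \<in> {a \<in> carrier R. I +> a \<in> J}" using a_Hcarr[OF a] by blast
  qed
qed

text \<open>This is the correspondence theorem applied to whole chains, so that lengths of quotients
  can be computed with ideals of \<open>R\<close> that contain \<open>I\<close>. Preimages stay
  strict because the projection is surjective, images because the smaller ideal contains
  \<open>I\<close>.\<close>

lemma (in ideal) ring_length_Quot:
  "ring_length (R Quot I) = (SUP n\<in>{n. ideal_chain n R I}. enat n)"
proof -
  interpret h: ring_hom_ring R "R Quot I" "(+>) I" by (rule rcos_ring_hom_ring)
  have "(\<exists>J. (\<forall>i\<le>n. ideal (J i) (R Quot I)) \<and> (\<forall>i<n. J i \<subset> J (Suc i))) \<longleftrightarrow> ideal_chain n R I"
    for n
  proof
    assume "\<exists>J. (\<forall>i\<le>n. ideal (J i) (R Quot I)) \<and> (\<forall>i<n. J i \<subset> J (Suc i))"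
    then obtain J where J: "\<And>i. i \<le> n \<Longrightarrow> ideal (J i) (R Quot I)" "\<And>i. i < n \<Longrightarrow> J i \<subset> J (Suc i)"
      by blast
    define J' where "J' i = {a \<in> carrier R. I +> a \<in> J i}" for i
    have "J' i \<subset> J' (Suc i)" if i: "i < n" for i
    proof -
      obtain q where q: "q \<in> J (Suc i)" "q \<notin> J i" using J(2)[OF i] by blast
      then have "q \<in> carrier (R Quot I)"
        using additive_subgroup.a_Hcarr[OF ideal.axioms(1)[OF J(1)[of "Suc i"]]] i by simp
      then obtain a where "a \<in> carrier R" "q = I +> a" by (auto simp: carrier_Quot)
      with q J(2)[OF i] show ?thesis by (auto simp: J'_def)
    qed
    then show "ideal_chain n R I"
      unfolding ideal_chain_def using ideal_Quot_vimage[OF J(1)]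
      by (intro exI[of _ J']) (simp add: J'_def)
  next
    assume "ideal_chain n R I"
    then obtain J where J: "\<And>i. i \<le> n \<Longrightarrow> ideal (J i) R" "\<And>i. i \<le> n \<Longrightarrow> I \<subseteq> J i"
      "\<And>i. i < n \<Longrightarrow> J i \<subset> J (Suc i)"
      unfolding ideal_chain_def by blast
    have "(+>) I ` J i \<subset> (+>) I ` J (Suc i)" if i: "i < n" for i
    proof -
      interpret Ji: ideal "J i" R using J(1) i by simp
      interpret Js: ideal "J (Suc i)" R using J(1) i by simp
      obtain a where a: "a \<in> J (Suc i)" "a \<notin> J i" using J(3)[OF i] by blast
      \<comment> \<open>If the cosets agreed, \<open>a\<close> would differ from an element of
        \<open>J i\<close> by an element of \<open>I\<close>, which also lies in
        \<open>J i\<close>.\<close>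
      have "I +> a \<notin> (+>) I ` J i"
      proof
        assume "I +> a \<in> (+>) I ` J i"
        then obtain b where b: "b \<in> J i" "I +> a = I +> b" by blast
        then have "a \<ominus> b \<in> J i"
          using rcos_eq_iff[of a b] a J(2)[of i] i by (auto intro: Js.a_Hcarr Ji.a_Hcarr)
        then have "(a \<ominus> b) \<oplus> b \<in> J i" using b by simp
        moreover have "(a \<ominus> b) \<oplus> b = a"
          using Js.a_Hcarr[OF a(1)] Ji.a_Hcarr[OF b(1)] by algebra
        ultimately show False using a by simp
      qed
      then show ?thesis using a J(3)[OF i] by blast
    qed
    then show "\<exists>J. (\<forall>i\<le>n. ideal (J i) (R Quot I)) \<and> (\<forall>i<n. J i \<subset> J (Suc i))"
      using ideal_Quot_image[OF J(1,2)] by (intro exI[of _ "\<lambda>i. (+>) I ` J i"]) simp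
  qed
  then show ?thesis unfolding ring_length_def by simp
qed

section \<open>Subrings of a commutative ring\<close>

text \<open>The rings of the statement are types with ring operations, restricted to a carrier.
  Working with such a subset keeps type-class arithmetic available; the record \<open>Rng\<close>
  appears only where ideals, quotients and lengths are compared.\<close>

locale type_subring =
  fixes R :: "'a::comm_ring_1 set"
  assumes zero_closed [simp, intro]: "0 \<in> R"
    and one_closed [simp, intro]: "1 \<in> R"
    and add_closed [simp, intro]: "a \<in> R \<Longrightarrow> b \<in> R \<Longrightarrow> a + b \<in> R"
    and uminus_closed [simp, intro]: "a \<in> R \<Longrightarrow> - a \<in> R"
    and mult_closed [simp, intro]: "a \<in> R \<Longrightarrow> b \<in> R \<Longrightarrow> a * b \<in> R"
begin

lemma diff_closed [simp, intro]: "a \<in> R \<Longrightarrow> b \<in> R \<Longrightarrow> a - b \<in> R"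
  using add_closed[of a "- b"] by simp

lemma power_closed [simp, intro]: "a \<in> R \<Longrightarrow> a ^ n \<in> R"
  by (induction n) auto

abbreviation Rng :: "'a ring" where
  "Rng \<equiv> ring_of_type_algebra\<lparr>carrier := R\<rparr>"

lemma Rng_simps:
  "carrier Rng = R" "a \<otimes>\<^bsub>Rng\<^esub> b = a * b" "a \<oplus>\<^bsub>Rng\<^esub> b = a + b" "\<zero>\<^bsub>Rng\<^esub> = 0" "\<one>\<^bsub>Rng\<^esub> = 1"
  by (simp_all add: ring_of_type_algebra_def)

lemma cring_Rng: "cring Rng"
proof -
  have "\<exists>b\<in>R. a + b = 0" if "a \<in> R" for a
    using that by (intro bexI[of _ "- a"]) auto
  then show ?thesis
    unfolding ring_of_type_algebra_def
    by unfold_locales (auto simp: algebra_simps Units_def)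
qed

definition is_ideal :: "'a set \<Rightarrow> bool" where
  "is_ideal A \<longleftrightarrow> A \<subseteq> R \<and> 0 \<in> A \<and> (\<forall>a\<in>A. \<forall>b\<in>A. a + b \<in> A) \<and> (\<forall>a\<in>A. \<forall>r\<in>R. r * a \<in> A)"

lemma is_idealD:
  assumes "is_ideal A"
  shows "A \<subseteq> R" "0 \<in> A" "a \<in> A \<Longrightarrow> b \<in> A \<Longrightarrow> a + b \<in> A" "a \<in> A \<Longrightarrow> r \<in> R \<Longrightarrow> r * a \<in> A"
    "a \<in> A \<Longrightarrow> b \<in> A \<Longrightarrow> a - b \<in> A"
proof -
  show "a - b \<in> A" if "a \<in> A" "b \<in> A"
    using assms that uminus_closed[OF one_closed] unfolding is_ideal_def
    by (metis diff_conv_add_uminus mult_minus1)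
qed (use assms in \<open>auto simp: is_ideal_def\<close>)

lemma ideal_Rng_iff: "ideal A Rng \<longleftrightarrow> is_ideal A"
proof
  assume "ideal A Rng"
  then interpret ideal A Rng .
  have "0 \<in> A"
    using additive_subgroup.zero_closed[OF additive_subgroup_axioms] by (simp only: Rng_simps)
  moreover have "a + b \<in> A" if "a \<in> A" "b \<in> A" for a b
    using additive_subgroup.a_closed[OF additive_subgroup_axioms that] by (simp only: Rng_simps)
  moreover have "r * a \<in> A" if "a \<in> A" "r \<in> R" for a r
    using I_l_closed[of a r] that by (simp only: Rng_simps)
  moreover have "A \<subseteq> R" using a_subset by (simp only: Rng_simps)
  ultimately show "is_ideal A" unfolding is_ideal_def by blast
next
  assume A: "is_ideal A"
  interpret cring Rng by (rule cring_Rng)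
  show "ideal A Rng"
  proof (rule idealI[OF ring_axioms])
    show "subgroup A (add_monoid Rng)"
    proof (rule group.subgroupI)
      show "inv\<^bsub>add_monoid Rng\<^esub> a \<in> A" if "a \<in> A" for a
      proof -
        have "- a \<in> A" "a \<in> R" "- a \<in> R"
          using is_idealD(1)[OF A] is_idealD(5)[OF A is_idealD(2)[OF A] that] that by auto
        then have "inv\<^bsub>add_monoid Rng\<^esub> a = - a"
          by (intro group.inv_equality[OF a_group]) (auto simp: ring_of_type_algebra_def)
        with \<open>- a \<in> A\<close> show ?thesis by simp
      qed
    qed (use is_idealD[OF A] a_group in \<open>auto simp: ring_of_type_algebra_def\<close>)
    show "a \<otimes>\<^bsub>Rng\<^esub> b \<in> A" if "a \<in> A" "b \<in> carrier Rng" for a b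
      using is_idealD(4)[OF A that(1), of b] that
      by (simp add: ring_of_type_algebra_def mult.commute)
  qed (use is_idealD[OF A] in \<open>auto simp: ring_of_type_algebra_def\<close>)
qed

text \<open>The recursion peels off the first generator. Composition series use this form: a step
  compares the ideal of a list with that of its tail.\<close>

primrec idl :: "'a list \<Rightarrow> 'a set" where
  "idl [] = {0}"
| "idl (g # gs) = {a * g + r | a r. a \<in> R \<and> r \<in> idl gs}"

lemma idl_ConsI: "f = a * g + r \<Longrightarrow> a \<in> R \<Longrightarrow> r \<in> idl gs \<Longrightarrow> f \<in> idl (g # gs)"
  by auto

lemma is_ideal_idl:
  assumes "set gs \<subseteq> R"
  shows "is_ideal (idl gs)"
  using assms
proof (induction gs)
  case Nil
  then show ?case by (simp add: is_ideal_def)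
next
  case (Cons g gs)
  then have IH: "is_ideal (idl gs)" "g \<in> R" by auto
  show ?case
    unfolding is_ideal_def
  proof (intro conjI ballI)
    show "idl (g # gs) \<subseteq> R" using IH is_idealD(1) by auto
    show "0 \<in> idl (g # gs)" using IH(1) is_idealD(2) by force
  next
    fix a b assume "a \<in> idl (g # gs)" "b \<in> idl (g # gs)"
    then obtain u r v s where "a = u * g + r" "b = v * g + s" "u \<in> R" "v \<in> R" "r \<in> idl gs" "s \<in> idl gs"
      by auto
    moreover from this have "a + b = (u + v) * g + (r + s)" by (simp add: algebra_simps)
    ultimately show "a + b \<in> idl (g # gs)"
      using is_idealD(3)[OF IH(1)] by (intro idl_ConsI[of _ "u + v" g "r + s"]) auto
  next
    fix a b assume "a \<in> idl (g # gs)" "b \<in> R"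
    moreover from this obtain u r where "a = u * g + r" "u \<in> R" "r \<in> idl gs" by auto
    moreover from this have "b * a = (b * u) * g + b * r" by (simp add: algebra_simps)
    ultimately show "b * a \<in> idl (g # gs)"
      using is_idealD(4)[OF IH(1)] by (intro idl_ConsI[of _ "b * u" g "b * r"]) auto
  qed
qed

lemma idl_gen: "set gs \<subseteq> R \<Longrightarrow> g \<in> set gs \<Longrightarrow> g \<in> idl gs"
proof (induction gs)
  case (Cons h gs)
  have "h \<in> idl (h # gs)"
    using is_idealD(2)[OF is_ideal_idl, of gs] Cons.prems by (intro idl_ConsI[of _ 1 h 0]) auto
  moreover have "g \<in> idl (h # gs)" if "g \<in> idl gs"
    using that by (intro idl_ConsI[of _ 0 h g]) auto
  ultimately show ?case using Cons by auto
qed simp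

lemma idl_subset: "is_ideal A \<Longrightarrow> set gs \<subseteq> A \<Longrightarrow> idl gs \<subseteq> A"
  by (induction gs) (auto simp: is_idealD)

lemma idl_eqI:
  assumes "set gs \<subseteq> R" "set hs \<subseteq> R" "set gs \<subseteq> idl hs" "set hs \<subseteq> idl gs"
  shows "idl gs = idl hs"
  using assms by (intro antisym idl_subset is_ideal_idl)

lemma idl1_iff: "f \<in> idl [g1] \<longleftrightarrow> (\<exists>a\<in>R. f = a * g1)"
  by auto

lemma idl2_iff: "f \<in> idl [g1, g2] \<longleftrightarrow> (\<exists>a\<in>R. \<exists>b\<in>R. f = a * g1 + b * g2)"
  by auto

lemma idl2I: "a \<in> R \<Longrightarrow> b \<in> R \<Longrightarrow> f = a * g1 + b * g2 \<Longrightarrow> f \<in> idl [g1, g2]"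
  unfolding idl2_iff by blast

lemma idl3I:
  "a \<in> R \<Longrightarrow> b \<in> R \<Longrightarrow> c \<in> R \<Longrightarrow> f = a * g1 + (b * g2 + c * g3) \<Longrightarrow> f \<in> idl [g1, g2, g3]"
  by (intro idl_ConsI[of f a g1] idl2I[of b c]) auto

lemma idl3_iff:
  "f \<in> idl [g1, g2, g3] \<longleftrightarrow> (\<exists>a\<in>R. \<exists>b\<in>R. \<exists>c\<in>R. f = a * g1 + (b * g2 + c * g3))"
  by (simp only: idl.simps(2)[of g1] idl2_iff mem_Collect_eq) blast

lemma idl4I:
  "a \<in> R \<Longrightarrow> b \<in> R \<Longrightarrow> c \<in> R \<Longrightarrow> d \<in> R \<Longrightarrow>
     f = a * g1 + (b * g2 + (c * g3 + d * g4)) \<Longrightarrow> f \<in> idl [g1, g2, g3, g4]"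
  by (intro idl_ConsI[of f a g1] idl3I[of b c d]) auto

lemma idl4_iff:
  "f \<in> idl [g1, g2, g3, g4] \<longleftrightarrow>
     (\<exists>a\<in>R. \<exists>b\<in>R. \<exists>c\<in>R. \<exists>d\<in>R. f = a * g1 + (b * g2 + (c * g3 + d * g4)))"
  by (simp only: idl.simps(2)[of g1] idl3_iff mem_Collect_eq) blast

declare idl.simps [simp del]

lemma genideal_subset_ideal: "is_ideal A \<Longrightarrow> S \<subseteq> A \<Longrightarrow> genideal Rng S \<subseteq> A"
  unfolding genideal_def ideal_Rng_iff by blast

lemma genideal_superset: "S \<subseteq> genideal Rng S"
  unfolding genideal_def by blast

lemma is_ideal_genideal: "S \<subseteq> R \<Longrightarrow> is_ideal (genideal Rng S)"
  using ring.genideal_ideal[OF cring.axioms(1)[OF cring_Rng]]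
  by (simp add: ideal_Rng_iff[symmetric] Rng_simps)

lemma genideal_set_eq_idl:
  assumes "set gs \<subseteq> R"
  shows "genideal Rng (set gs) = idl gs"
proof
  show "genideal Rng (set gs) \<subseteq> idl gs"
    using assms idl_gen by (intro genideal_subset_ideal is_ideal_idl) auto
  show "idl gs \<subseteq> genideal Rng (set gs)"
    using assms genideal_superset by (intro idl_subset is_ideal_genideal)
qed

end

lemma type_subring_UNIV: "type_subring UNIV"
  by unfold_locales auto

section \<open>Composition series in a two-dimensional regular local ring\<close>

text \<open>
  A local ring \<open>R\<close> inside its fraction field, with residue field \<open>k \<subseteq> R\<close> and maximal ideal
  generated by the regular sequence \<open>x, y\<close>.
\<close>

locale regular_local2 = type_subring R for R :: "'a::field set" +
  fixes k :: "'a set" and x y :: 'a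
  assumes k_subset: "k \<subseteq> R"
    and k_inverse: "c \<in> k \<Longrightarrow> inverse c \<in> k"
    and x_closed [simp, intro]: "x \<in> R"
    and y_closed [simp, intro]: "y \<in> R"
    and x_nonzero: "x \<noteq> 0"
    and residue: "a \<in> R \<Longrightarrow> \<exists>c\<in>k. \<exists>b\<in>R. \<exists>d\<in>R. a = c + x * b + y * d"
    and unit_or_nonunit: "a \<in> R \<Longrightarrow> inverse a \<in> R \<or> (\<exists>b\<in>R. \<exists>d\<in>R. a = x * b + y * d)"
    and proper: "b \<in> R \<Longrightarrow> d \<in> R \<Longrightarrow> x * b + y * d \<noteq> 1"
    and regular: "a \<in> R \<Longrightarrow> b \<in> R \<Longrightarrow> y * b = x * a \<Longrightarrow> \<exists>c\<in>R. b = x * c"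
begin

text \<open>The quotient A/B is spanned over \<open>k\<close> by one nonzero class. As nonzero
  elements of \<open>k\<close> are units, no ideal lies strictly between B and A.\<close>

definition series_step :: "'a set \<Rightarrow> 'a set \<Rightarrow> bool" where
  "series_step A B \<longleftrightarrow>
     is_ideal A \<and> is_ideal B \<and> B \<subseteq> A \<and> (\<exists>e\<in>A. e \<notin> B \<and> (\<forall>f\<in>A. \<exists>c\<in>k. f - c * e \<in> B))"

definition comp_series :: "nat \<Rightarrow> 'a set \<Rightarrow> 'a set \<Rightarrow> bool" where
  "comp_series n A B \<longleftrightarrow> (\<exists>L. L 0 = A \<and> L n = B \<and> (\<forall>i<n. series_step (L i) (L (Suc i))))"

lemma comp_seriesI:
  assumes "\<And>i. i < n \<Longrightarrow> series_step (L i) (L (Suc i))" "L 0 = A" "L n = B"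
  shows "comp_series n A B"
  unfolding comp_series_def using assms by blast

lemma comp_series_trans:
  assumes "comp_series m A B" "comp_series n B C"
  shows "comp_series (m + n) A C"
proof -
  obtain L where L: "L 0 = A" "L m = B" "\<And>i. i < m \<Longrightarrow> series_step (L i) (L (Suc i))"
    using assms(1) unfolding comp_series_def by blast
  obtain M where M: "M 0 = B" "M n = C" "\<And>i. i < n \<Longrightarrow> series_step (M i) (M (Suc i))"
    using assms(2) unfolding comp_series_def by blast
  define N where "N i = (if i \<le> m then L i else M (i - m))" for i
  have "series_step (N i) (N (Suc i))" if "i < m + n" for i
  proof (cases "i < m")
    case True
    then show ?thesis using L(3) by (simp add: N_def)
  next
    case False
    then have "N i = M (i - m)" "N (Suc i) = M (Suc (i - m))"
      using L(2) M(1) by (auto simp: N_def Suc_diff_le)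
    then show ?thesis using M(3)[of "i - m"] that False by simp
  qed
  moreover have "N 0 = A" "N (m + n) = C" using L M by (auto simp: N_def)
  ultimately show ?thesis by (intro comp_seriesI)
qed

text \<open>
  For the upper bound, send an ideal \<open>J\<close> to the set of those \<open>i\<close> for which \<open>J\<close> contains an
  element of the form \<open>e i + l\<close> with \<open>l\<close> in the next member of the series. This map is strictly
  monotone.
\<close>

lemma ring_length_comp_series:
  assumes "comp_series n R I" "is_ideal I"
  shows "ring_length (Rng Quot I) = enat n"
proof -
  obtain L where L: "L 0 = R" "L n = I" "\<And>i. i < n \<Longrightarrow> series_step (L i) (L (Suc i))"
    using assms(1) unfolding comp_series_def by blast
  have L_ideal: "is_ideal (L i)" if "i \<le> n" for i
  proof (cases "i < n")
    case True
    then show ?thesis using L(3) unfolding series_step_def by blast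
  next
    case False
    then show ?thesis using that assms(2) L(2) by simp
  qed
  have "\<forall>i<n. \<exists>e\<in>L i. e \<notin> L (Suc i) \<and> (\<forall>f\<in>L i. \<exists>c\<in>k. f - c * e \<in> L (Suc i))"
    using L(3) unfolding series_step_def by blast
  then obtain e where e: "\<And>i. i < n \<Longrightarrow> e i \<in> L i" "\<And>i. i < n \<Longrightarrow> e i \<notin> L (Suc i)"
    "\<And>i f. i < n \<Longrightarrow> f \<in> L i \<Longrightarrow> \<exists>c\<in>k. f - c * e i \<in> L (Suc i)"
    by metis
  have upper: "m \<le> n" if chain: "ideal_chain m Rng I" for m
  proof -
    obtain J where J: "\<And>i. i \<le> m \<Longrightarrow> is_ideal (J i)" "\<And>i. i \<le> m \<Longrightarrow> I \<subseteq> J i"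
      "\<And>i. i < m \<Longrightarrow> J i \<subset> J (Suc i)"
      using chain unfolding ideal_chain_def ideal_Rng_iff by blast
    define T where "T A = {i. i < n \<and> (\<exists>f\<in>A. f - e i \<in> L (Suc i))}" for A
    have eq: "B \<subseteq> A"
      if A: "is_ideal A" and B: "is_ideal B" and "I \<subseteq> A" and AB: "A \<subseteq> B" and TBA: "T B \<subseteq> T A" for A B
    proof -
      \<comment> \<open>Induction on the distance j from the bottom \<open>L n = I\<close>, where
        the inclusion in \<open>A\<close> is known.\<close>
      have "j \<le> n \<Longrightarrow> f \<in> B \<Longrightarrow> f \<in> L (n - j) \<Longrightarrow> f \<in> A" for j f
      proof (induction j arbitrary: f)
        case 0
        then show ?case using \<open>I \<subseteq> A\<close> L(2) by auto
      next
        case (Suc j)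
        define i where "i = n - Suc j"
        have i: "i < n" "Suc i = n - j" using Suc.prems(1) by (auto simp: i_def)
        note LS = L_ideal[of "Suc i"]
        obtain c where c: "c \<in> k" "f - c * e i \<in> L (Suc i)"
          using e(3)[OF i(1)] Suc.prems(3) unfolding i_def by blast
        show ?case
        proof (cases "c = 0")
          case True
          then show ?thesis using c Suc i by simp
        next
          case False
          \<comment> \<open>Scaling f by the inverse of its leading coefficient c shows that i lies
            in \<open>T B\<close>, hence in \<open>T A\<close>. This gives g in \<open>A\<close>
            with leading term \<open>e i\<close>, and subtracting c g from f moves it one step down
            the series.\<close>
          have c': "c \<in> R" "inverse c \<in> R" using c(1) k_inverse k_subset by auto
          have "inverse c * f - e i = inverse c * (f - c * e i)"
            using False by (simp add: field_simps)
          then have "inverse c * f - e i \<in> L (Suc i)"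
            using is_idealD(4)[OF LS c(2) c'(2)] i by simp
          then have "i \<in> T B"
            using i is_idealD(4)[OF B Suc.prems(2) c'(2)] unfolding T_def by blast
          then obtain g where g: "g \<in> A" "g - e i \<in> L (Suc i)"
            using TBA unfolding T_def by blast
          have fg: "f - c * g = (f - c * e i) - c * (g - e i)" by (simp add: algebra_simps)
          have "f - c * g \<in> L (Suc i)"
            unfolding fg using is_idealD(5)[OF LS c(2) is_idealD(4)[OF LS g(2) c'(1)]] i by simp
          moreover have "c * g \<in> A" using is_idealD(4)[OF A g(1) c'(1)] .
          moreover from this have "f - c * g \<in> B"
            using is_idealD(5)[OF B Suc.prems(2)] AB by blast
          ultimately have "f - c * g \<in> A" using Suc.IH[of "f - c * g"] Suc.prems(1) i by simp
          then have "(f - c * g) + c * g \<in> A"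
            using \<open>c * g \<in> A\<close> is_idealD(3)[OF A] by blast
          then show ?thesis by simp
        qed
      qed
      from this[of n] show ?thesis using L(1) is_idealD(1)[OF B] by auto
    qed
    have "i \<le> card (T (J i))" if "i \<le> m" for i
      using that
    proof (induction i)
      case (Suc i)
      have "J i \<subset> J (Suc i)" using J(3) Suc.prems by simp
      moreover from this have "T (J i) \<subseteq> T (J (Suc i))" unfolding T_def by blast
      ultimately have "T (J i) \<subset> T (J (Suc i))"
        using eq[OF J(1)[of i] J(1)[of "Suc i"] J(2)[of i]] Suc.prems by auto
      moreover have "finite (T (J (Suc i)))" unfolding T_def by simp
      ultimately have "card (T (J i)) < card (T (J (Suc i)))" by (simp add: psubset_card_mono)
      then show ?case using Suc by simp
    qed simp
    moreover have "card (T A) \<le> n" for A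
    proof -
      have "T A \<subseteq> {..<n}" unfolding T_def by auto
      then show ?thesis using card_mono[of "{..<n}" "T A"] by simp
    qed
    ultimately show ?thesis by (meson le_trans order_refl)
  qed
  \<comment> \<open>Conversely, the series read from the bottom is a chain of n strict inclusions,
    so the bound is attained.\<close>
  have "L n \<subseteq> L i" if "i \<le> n" for i
    using that
  proof (induction "n - i" arbitrary: i)
    case (Suc d)
    then have "L n \<subseteq> L (Suc i)" by simp
    moreover have "L (Suc i) \<subseteq> L i" using L(3)[of i] Suc unfolding series_step_def by simp
    ultimately show ?case by blast
  qed simp
  moreover have "L (n - i) \<subset> L (n - Suc i)" if "i < n" for i
  proof -
    have "Suc (n - Suc i) = n - i" using that by simp
    then show ?thesis
      using L(3)[of "n - Suc i"] that unfolding series_step_def by auto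
  qed
  ultimately have "ideal_chain n Rng I"
    unfolding ideal_chain_def ideal_Rng_iff
    using L(2) L_ideal by (intro exI[of _ "\<lambda>i. L (n - i)"]) auto
  then have "(SUP n\<in>{n. ideal_chain n Rng I}. enat n) = enat n"
    using upper by (intro antisym SUP_least SUP_upper) auto
  moreover have "ideal I Rng" using assms(2) ideal_Rng_iff by simp
  ultimately show ?thesis by (simp add: ideal.ring_length_Quot)
qed

text \<open>Both generators of the maximal ideal carry \<open>e\<close> into \<open>idl gs\<close>,
  so only the residue in \<open>k\<close> of a coefficient of \<open>e\<close> matters.\<close>

lemma series_step_idl:
  assumes "set gs \<subseteq> R" "e \<in> R" "e \<notin> idl gs" "x * e \<in> idl gs" "y * e \<in> idl gs"
  shows "series_step (idl (e # gs)) (idl gs)"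
proof -
  have "\<exists>c\<in>k. f - c * e \<in> idl gs" if fe: "f \<in> idl (e # gs)" for f
  proof -
    obtain a r where f: "f = a * e + r" "a \<in> R" "r \<in> idl gs" using fe by (auto simp: idl.simps)
    obtain c b d where cbd: "c \<in> k" "b \<in> R" "d \<in> R" "a = c + x * b + y * d"
      using residue[OF f(2)] by blast
    have "f - c * e = (b * (x * e) + d * (y * e)) + r" using f cbd by (simp add: algebra_simps)
    also have "\<dots> \<in> idl gs"
      using is_idealD[OF is_ideal_idl[OF assms(1)]] assms cbd f by auto
    finally show ?thesis using cbd by blast
  qed
  moreover have "is_ideal (idl (e # gs))" "is_ideal (idl gs)"
    using assms by (simp_all add: is_ideal_idl del: idl.simps)
  moreover have "idl gs \<subseteq> idl (e # gs)" by (intro subsetI idl_ConsI[of _ 0]) auto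
  moreover have "e \<in> idl (e # gs)" using assms by (intro idl_gen) auto
  ultimately show ?thesis using assms(3) unfolding series_step_def by blast
qed

text \<open>Multiplication by y is injective modulo x, hence so is multiplication by its
  powers.\<close>

lemma x_cancel_power:
  assumes "a \<in> R" "b \<in> R" "y ^ n * b = x * a"
  shows "\<exists>c\<in>R. b = x * c"
  using assms
proof (induction n arbitrary: a)
  case (Suc n)
  have "y * (y ^ n * b) = x * a" using Suc.prems by (simp add: mult.assoc)
  then obtain c where "c \<in> R" "y ^ n * b = x * c"
    using regular[of a "y ^ n * b"] Suc.prems by auto
  then show ?case using Suc by blast
qed auto

text \<open>Cancelling y^j modulo x would put 1 into the maximal ideal. All strictness claims in the
  length computation are reduced to this contradiction.\<close>

lemma power_y_notin:
  assumes "a \<in> R" "b \<in> R" "y ^ j = x * a + y ^ Suc j * b"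
  shows False
proof -
  have "y ^ j * (1 - y * b) = x * a" using assms(3) by (simp add: algebra_simps)
  then obtain c where "c \<in> R" "1 - y * b = x * c"
    using x_cancel_power[of a "1 - y * b" j] assms(1,2) by auto
  then show False using proper[of c b] assms(1,2) by (simp add: algebra_simps)
qed

text \<open>Since x e already lies in \<open>idl gs\<close>, the class of e generates a module over
  R/(x), which is filtered by powers of y. It remains to check that consecutive powers give
  different ideals.\<close>

lemma comp_series_idl:
  assumes R: "set gs \<subseteq> R" "e \<in> R" and xe: "x * e \<in> idl gs"
    and notin: "\<And>i. i < n \<Longrightarrow> y ^ i * e \<notin> idl (y ^ Suc i * e # gs)"
  shows "comp_series n (idl (e # gs)) (idl (y ^ n * e # gs))"
proof (rule comp_seriesI[where L = "\<lambda>i. idl (y ^ i * e # gs)"])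
  fix i assume i: "i < n"
  let ?hs = "y ^ Suc i * e # gs"
  have hs: "set ?hs \<subseteq> R" using R by auto
  have "y ^ i * (x * e) \<in> idl gs" using is_idealD(4)[OF is_ideal_idl xe] R by auto
  then have "x * (y ^ i * e) \<in> idl ?hs"
    by (intro idl_ConsI[of _ 0 _ "x * (y ^ i * e)"]) (auto simp: mult_ac)
  moreover have "y * (y ^ i * e) \<in> idl ?hs"
    using idl_gen[OF hs, of "y ^ Suc i * e"] by (simp add: mult_ac)
  ultimately have "series_step (idl (y ^ i * e # ?hs)) (idl ?hs)"
    using series_step_idl[OF hs, of "y ^ i * e"] R notin[OF i] by simp
  \<comment> \<open>\<open>series_step_idl\<close> puts a new generator in front of the smaller
    ideal; the old one, y times the new one, becomes redundant.\<close>
  moreover have "idl (y ^ i * e # ?hs) = idl (y ^ i * e # gs)"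
  proof (rule idl_eqI)
    show "set (y ^ i * e # ?hs) \<subseteq> R" "set (y ^ i * e # gs) \<subseteq> R" using R by auto
    then show "set (y ^ i * e # gs) \<subseteq> idl (y ^ i * e # ?hs)"
      using idl_gen[of "y ^ i * e # ?hs"] by auto
    have R': "set (y ^ i * e # gs) \<subseteq> R" using R by auto
    have "y ^ Suc i * e \<in> idl (y ^ i * e # gs)"
      using is_idealD(4)[OF is_ideal_idl[OF R'] idl_gen[OF R'], of "y ^ i * e" y]
      by (simp add: mult_ac)
    then show "set (y ^ i * e # ?hs) \<subseteq> idl (y ^ i * e # gs)"
      using idl_gen[OF R'] by auto
  qed
  ultimately show "series_step (idl (y ^ i * e # gs)) (idl ?hs)" by simp
qed simp_all

text \<open>
  The length \<open>2a + 2b\<close> is the sum of the lengths of \<open>(1)/(x, p)\<close>, \<open>(x, p)/(x\<^sup>2, p)\<close>,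
  \<open>(x\<^sup>2, p)/(x\<^sup>3, x\<^sup>2 q, p)\<close> and \<open>(x\<^sup>3, x\<^sup>2 q, p)/(x\<^sup>4, x\<^sup>2 q, p)\<close>.
\<close>

lemma x_divides_left:
  assumes "u \<in> R" "u \<noteq> 0" "inverse u \<in> R" "w \<in> R" "r \<in> R" "t \<in> R"
    and "r * (u * y ^ n + x * w) = x * t"
  shows "\<exists>c\<in>R. r = x * c"
proof -
  have "y ^ n * (r * u) = x * (t - r * w)" using assms(7) by (simp add: algebra_simps)
  then obtain c where "c \<in> R" "r * u = x * c"
    using x_cancel_power[of "t - r * w" "r * u" n] assms(1-6) by auto
  then have "r = x * (c * inverse u)" using assms(2) by (simp add: field_simps)
  then show ?thesis using \<open>c \<in> R\<close> assms by blast
qed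

text \<open>Modulo x, every multiple of u y^n + x w is divisible by y^n, hence by y^(i+1). Such a
  multiple therefore cannot produce y^i.\<close>

lemma mod_xy_power:
  assumes "u \<in> R" "w \<in> R" "r \<in> R" "i < n"
  shows "\<exists>c\<in>R. \<exists>d\<in>R. r * (u * y ^ n + x * w) = y ^ Suc i * c + x * d"
proof -
  have "y ^ n = y ^ Suc i * y ^ (n - Suc i)"
    using assms(4) by (simp del: power_Suc flip: power_add)
  then have "r * (u * y ^ n + x * w) = y ^ Suc i * (r * u * y ^ (n - Suc i)) + x * (r * w)"
    by (simp add: algebra_simps del: power_Suc)
  then show ?thesis using assms by blast
qed

theorem ring_length_quadruple_line:
  assumes R: "u \<in> R" "inverse u \<in> R" "w \<in> R" "v \<in> R" "inverse v \<in> R" "s \<in> R" "g \<in> R" "h \<in> R"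
    and nz: "u \<noteq> 0" "v \<noteq> 0"
    and p: "p = u * y ^ a + x * w" and q: "q = v * y ^ b + x * s"
    and pq: "p = x ^ 2 * h + g * q" and ba: "b \<le> a"
  shows "ring_length (Rng Quot idl [x ^ 4, x ^ 2 * q, p]) = enat (2 * a + 2 * b)"
proof -
  have pR [simp]: "p \<in> R" and qR [simp]: "q \<in> R" unfolding p q using R by auto
  \<comment> \<open>Modulo x, both p and q are a unit times a power of y, hence nonzerodivisors.
    This permits a factor x to be moved from a product to its coefficient.\<close>
  have x_div_p: "\<exists>c\<in>R. r = x * c" if "r \<in> R" "t \<in> R" "r * p = x * t" for r t
    using x_divides_left[of u w r t a] that R nz by (simp add: p)
  have x_div_q: "\<exists>c\<in>R. r = x * c" if "r \<in> R" "t \<in> R" "r * q = x * t" for r t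
    using x_divides_left[of v s r t b] that R nz by (simp add: q)
  have p_mod: "\<exists>c\<in>R. \<exists>d\<in>R. r * p = y ^ Suc i * c + x * d" if "i < a" "r \<in> R" for r i
    using mod_xy_power[of u w r i a] that R by (simp add: p)
  have q_mod: "\<exists>c\<in>R. \<exists>d\<in>R. r * q = y ^ Suc i * c + x * d" if "i < b" "r \<in> R" for r i
    using mod_xy_power[of v s r i b] that R by (simp add: q)
  have cancel: "m = n" if "x * m = x * n" for m n using that x_nonzero by simp
  \<comment> \<open>Modulo x, y^a and p generate the same ideal because u is a unit; the same holds
    for y^b and q. So the bottom of each layer can be rewritten with p or q.\<close>
  have ya: "y ^ a = (- (inverse u * w)) * x + inverse u * p"
    using nz by (simp add: p field_simps)
  have yb: "y ^ b = (- (inverse v * s)) * x + inverse v * q"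
    using nz by (simp add: q field_simps)
  note idl_iffs = idl1_iff idl2_iff idl3_iff idl4_iff

  \<comment> \<open>The redundant generator x^2 is added for the next layer: with head e = x, the
    tail has to contain x e for \<open>comp_series_idl\<close>. The later equalities add x^3 and x^4
    for the same reason.\<close>
  have eq1: "idl [y ^ a * 1, x] = idl [x, p, x ^ 2]"
  proof (rule idl_eqI)
    have "x \<in> idl [y ^ a * 1, x]" by (intro idl_gen) auto
    moreover have "p \<in> idl [y ^ a * 1, x]"
      by (rule idl2I[of u w])
        (use R in \<open>auto simp: p\<close>)
    moreover have "x ^ 2 \<in> idl [y ^ a * 1, x]"
      by (rule idl2I[of 0 x]) (auto simp: power2_eq_square)
    ultimately show "set [x, p, x ^ 2] \<subseteq> idl [y ^ a * 1, x]" by simp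
    have "y ^ a * 1 \<in> idl [x, p, x ^ 2]"
      by (rule idl3I[of "- (inverse u * w)" "inverse u" 0])
        (use R in \<open>auto simp: ya\<close>)
    moreover have "x \<in> idl [x, p, x ^ 2]" by (intro idl_gen) auto
    ultimately show "set [y ^ a * 1, x] \<subseteq> idl [x, p, x ^ 2]" by simp
  qed auto
  have "comp_series a (idl [1, x]) (idl [y ^ a * 1, x])"
  proof (rule comp_series_idl)
    show "x * 1 \<in> idl [x]" unfolding idl1_iff by (intro bexI[of _ 1]) auto
    show "y ^ i * 1 \<notin> idl [y ^ Suc i * 1, x]" for i
      using power_y_notin[of _ _ i] by (auto simp: idl2_iff mult_ac add_ac)
  qed auto
  moreover have "idl [1, x] = R"
  proof
    show "R \<subseteq> idl [1, x]"
      by (intro subsetI, rule idl2I[of _ 0]) auto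
  qed (rule is_idealD(1)[OF is_ideal_idl], simp)
  ultimately have s1: "comp_series a R (idl [x, p, x ^ 2])" using eq1 by simp

  have eq2: "idl [y ^ a * x, p, x ^ 2] = idl [x ^ 2, p, x ^ 3]"
  proof (rule idl_eqI)
    have "y ^ a * x \<in> idl [x ^ 2, p, x ^ 3]"
      by (rule idl3I[of "- (inverse u * w)" "inverse u * x" 0])
        (use R in \<open>auto simp: ya algebra_simps power2_eq_square\<close>)
    moreover have "p \<in> idl [x ^ 2, p, x ^ 3]" "x ^ 2 \<in> idl [x ^ 2, p, x ^ 3]"
      by (intro idl_gen; auto)+
    ultimately show "set [y ^ a * x, p, x ^ 2] \<subseteq> idl [x ^ 2, p, x ^ 3]" by simp
    have "p \<in> idl [y ^ a * x, p, x ^ 2]" "x ^ 2 \<in> idl [y ^ a * x, p, x ^ 2]"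
      by (intro idl_gen; auto)+
    moreover have "x ^ 3 \<in> idl [y ^ a * x, p, x ^ 2]"
      by (rule idl3I[of 0 0 x])
        (auto simp: power2_eq_square power3_eq_cube)
    ultimately show "set [x ^ 2, p, x ^ 3] \<subseteq> idl [y ^ a * x, p, x ^ 2]" by simp
  qed auto
  have "comp_series a (idl [x, p, x ^ 2]) (idl [y ^ a * x, p, x ^ 2])"
  proof (rule comp_series_idl)
    show "x * x \<in> idl [p, x ^ 2]"
      by (rule idl2I[of 0 1]) (auto simp: power2_eq_square)
    fix i assume i: "i < a"
    show "y ^ i * x \<notin> idl [y ^ Suc i * x, p, x ^ 2]"
    proof
      assume "y ^ i * x \<in> idl [y ^ Suc i * x, p, x ^ 2]"
      then obtain c r d where crd: "c \<in> R" "r \<in> R" "d \<in> R"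
        and eq: "y ^ i * x = c * (y ^ Suc i * x) + (r * p + d * x ^ 2)"
        unfolding idl_iffs by blast
      have "r * p = x * (y ^ i - c * y ^ Suc i - d * x)"
        using eq by (simp add: algebra_simps power2_eq_square)
      \<comment> \<open>Once r is known to be divisible by x, a factor x cancels from the whole
        relation. The deeper layers repeat this until only y^i is left.\<close>
      then obtain r1 where r1: "r1 \<in> R" "r = x * r1"
        using x_div_p[of r "y ^ i - c * y ^ Suc i - d * x"] crd by auto
      have "x * (y ^ i) = x * (c * y ^ Suc i + r1 * p + d * x)"
        using eq r1(2) by (simp add: algebra_simps power2_eq_square)
      then have "y ^ i = c * y ^ Suc i + r1 * p + d * x" by (rule cancel)
      moreover obtain m n where "m \<in> R" "n \<in> R" "r1 * p = y ^ Suc i * m + x * n"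
        using p_mod[OF i r1(1)] by blast
      ultimately show False
        using power_y_notin[of "n + d" "c + m" i] crd by (simp add: algebra_simps)
    qed
  qed auto
  then have s2: "comp_series a (idl [x, p, x ^ 2]) (idl [x ^ 2, p, x ^ 3])" using eq2 by simp

  have eq3: "idl [y ^ b * x ^ 2, p, x ^ 3] = idl [x ^ 3, x ^ 2 * q, p, x ^ 4]"
  proof (rule idl_eqI)
    have "y ^ b * x ^ 2 \<in> idl [x ^ 3, x ^ 2 * q, p, x ^ 4]"
      by (rule idl4I[of "- (inverse v * s)" "inverse v" 0 0])
        (use R in \<open>auto simp: yb algebra_simps power2_eq_square power3_eq_cube\<close>)
    moreover have "p \<in> idl [x ^ 3, x ^ 2 * q, p, x ^ 4]" "x ^ 3 \<in> idl [x ^ 3, x ^ 2 * q, p, x ^ 4]"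
      by (intro idl_gen; auto)+
    ultimately show "set [y ^ b * x ^ 2, p, x ^ 3] \<subseteq> idl [x ^ 3, x ^ 2 * q, p, x ^ 4]" by simp
    have "p \<in> idl [y ^ b * x ^ 2, p, x ^ 3]" "x ^ 3 \<in> idl [y ^ b * x ^ 2, p, x ^ 3]"
      by (intro idl_gen; auto)+
    moreover have "x ^ 2 * q \<in> idl [y ^ b * x ^ 2, p, x ^ 3]"
      by (rule idl3I[of v 0 s])
        (use R in \<open>auto simp: q algebra_simps power2_eq_square power3_eq_cube\<close>)
    moreover have "x ^ 4 \<in> idl [y ^ b * x ^ 2, p, x ^ 3]"
      by (rule idl3I[of 0 0 x])
        (auto simp: power3_eq_cube power4_eq_xxxx)
    ultimately show "set [x ^ 3, x ^ 2 * q, p, x ^ 4] \<subseteq> idl [y ^ b * x ^ 2, p, x ^ 3]" by simp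
  qed auto
  have "comp_series b (idl [x ^ 2, p, x ^ 3]) (idl [y ^ b * x ^ 2, p, x ^ 3])"
  proof (rule comp_series_idl)
    show "x * x ^ 2 \<in> idl [p, x ^ 3]"
      by (rule idl2I[of 0 1]) (auto simp: power2_eq_square power3_eq_cube)
    fix i assume "i < b"
    \<comment> \<open>At the levels i < b <= a, multiples of p have too high an order in y to
      produce y^i x^2. The layer ends at y^b because x^2 q enters there.\<close>
    then have i: "i < a" using ba by simp
    show "y ^ i * x ^ 2 \<notin> idl [y ^ Suc i * x ^ 2, p, x ^ 3]"
    proof
      assume "y ^ i * x ^ 2 \<in> idl [y ^ Suc i * x ^ 2, p, x ^ 3]"
      then obtain c r d where crd: "c \<in> R" "r \<in> R" "d \<in> R"
        and eq: "y ^ i * x ^ 2 = c * (y ^ Suc i * x ^ 2) + (r * p + d * x ^ 3)"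
        unfolding idl_iffs by blast
      let ?t = "y ^ i - c * y ^ Suc i - d * x"
      have "r * p = x * (x * ?t)"
        using eq by (simp add: algebra_simps power2_eq_square power3_eq_cube)
      moreover obtain r1 where r1: "r1 \<in> R" "r = x * r1"
        using x_div_p[of r "x * ?t"] calculation crd by auto
      ultimately have "x * (r1 * p) = x * (x * ?t)" by (simp add: mult.assoc)
      then have r1p: "r1 * p = x * ?t" by (rule cancel)
      then obtain r2 where r2: "r2 \<in> R" "r1 = x * r2"
        using x_div_p[of r1 ?t] r1 crd by auto
      with r1p have "x * (r2 * p) = x * ?t" by (simp add: mult.assoc)
      then have "r2 * p = ?t" by (rule cancel)
      moreover obtain m n where "m \<in> R" "n \<in> R" "r2 * p = y ^ Suc i * m + x * n"
        using p_mod[OF i r2(1)] by blast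
      ultimately show False
        using power_y_notin[of "n + d" "c + m" i] crd by (simp add: algebra_simps)
    qed
  qed auto
  then have s3: "comp_series b (idl [x ^ 2, p, x ^ 3]) (idl [x ^ 3, x ^ 2 * q, p, x ^ 4])"
    using eq3 by simp

  have eq4: "idl [y ^ b * x ^ 3, x ^ 2 * q, p, x ^ 4] = idl [x ^ 4, x ^ 2 * q, p]"
  proof (rule idl_eqI)
    have "y ^ b * x ^ 3 \<in> idl [x ^ 4, x ^ 2 * q, p]"
      by (rule idl3I[of "- (inverse v * s)" "inverse v * x" 0])
        (use R in \<open>auto simp: yb algebra_simps power2_eq_square power3_eq_cube power4_eq_xxxx\<close>)
    moreover have "p \<in> idl [x ^ 4, x ^ 2 * q, p]" "x ^ 4 \<in> idl [x ^ 4, x ^ 2 * q, p]"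
      "x ^ 2 * q \<in> idl [x ^ 4, x ^ 2 * q, p]"
      by (intro idl_gen; auto)+
    ultimately show "set [y ^ b * x ^ 3, x ^ 2 * q, p, x ^ 4] \<subseteq> idl [x ^ 4, x ^ 2 * q, p]" by simp
    show "set [x ^ 4, x ^ 2 * q, p] \<subseteq> idl [y ^ b * x ^ 3, x ^ 2 * q, p, x ^ 4]"
      by (intro subsetI idl_gen) auto
  qed auto
  have "comp_series b (idl [x ^ 3, x ^ 2 * q, p, x ^ 4]) (idl [y ^ b * x ^ 3, x ^ 2 * q, p, x ^ 4])"
  proof (rule comp_series_idl)
    show "x * x ^ 3 \<in> idl [x ^ 2 * q, p, x ^ 4]"
      by (rule idl3I[of 0 0 1])
        (auto simp: power3_eq_cube power4_eq_xxxx)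
    fix i assume i: "i < b"
    show "y ^ i * x ^ 3 \<notin> idl [y ^ Suc i * x ^ 3, x ^ 2 * q, p, x ^ 4]"
    proof
      assume "y ^ i * x ^ 3 \<in> idl [y ^ Suc i * x ^ 3, x ^ 2 * q, p, x ^ 4]"
      then obtain c m r d where crd: "c \<in> R" "m \<in> R" "r \<in> R" "d \<in> R"
        and eq: "y ^ i * x ^ 3 = c * (y ^ Suc i * x ^ 3) + (m * (x ^ 2 * q) + (r * p + d * x ^ 4))"
        unfolding idl_iffs by blast
      let ?t = "y ^ i - c * y ^ Suc i - d * x"
      have rp: "r * p = x * (x * (x * ?t - m * q))"
        using eq by (simp add: algebra_simps power2_eq_square power3_eq_cube power4_eq_xxxx)
      then obtain r1 where r1: "r1 \<in> R" "r = x * r1"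
        using x_div_p[of r "x * (x * ?t - m * q)"] crd by auto
      with rp have "x * (r1 * p) = x * (x * (x * ?t - m * q))" by (simp add: mult.assoc)
      then have r1p: "r1 * p = x * (x * ?t - m * q)" by (rule cancel)
      then obtain r2 where r2: "r2 \<in> R" "r1 = x * r2"
        using x_div_p[of r1 "x * ?t - m * q"] r1 crd by auto
      with r1p have "x * (r2 * p) = x * (x * ?t - m * q)" by (simp add: mult.assoc)
      then have "r2 * p = x * ?t - m * q" by (rule cancel)
      \<comment> \<open>Here \<open>pq\<close> enters: p is g q modulo x^2, so r2 p is absorbed into
        the coefficient of q up to a multiple of x. Then q, a nonzerodivisor modulo x, forces that
        coefficient to be divisible by x.\<close>
      then have mq: "(m + r2 * g) * q = x * (?t - r2 * x * h)"
        by (simp add: pq algebra_simps power2_eq_square)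
      then obtain m1 where m1: "m1 \<in> R" "m + r2 * g = x * m1"
        using x_div_q[of "m + r2 * g" "?t - r2 * x * h"] r2 crd R by auto
      with mq have "x * (m1 * q) = x * (?t - r2 * x * h)" by (simp add: mult.assoc)
      then have "m1 * q = ?t - r2 * x * h" by (rule cancel)
      moreover obtain e n where "e \<in> R" "n \<in> R" "m1 * q = y ^ Suc i * e + x * n"
        using q_mod[OF i m1(1)] by blast
      ultimately show False
        using power_y_notin[of "n + d + r2 * h" "c + e" i] crd r2 R by (simp add: algebra_simps)
    qed
  qed auto
  then have s4: "comp_series b (idl [x ^ 3, x ^ 2 * q, p, x ^ 4]) (idl [x ^ 4, x ^ 2 * q, p])"
    using eq4 by simp

  have "comp_series (a + (a + (b + b))) R (idl [x ^ 4, x ^ 2 * q, p])"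
    by (intro comp_series_trans[OF s1] comp_series_trans[OF s2] comp_series_trans[OF s3] s4)
  then have "ring_length (Rng Quot idl [x ^ 4, x ^ 2 * q, p]) = enat (a + (a + (b + b)))"
    by (rule ring_length_comp_series) (rule is_ideal_idl, simp)
  then show ?thesis by (simp add: mult_2)
qed

end

section \<open>Polynomials in three variables\<close>

lemma poly_mapping_sum_singles:
  fixes f :: "'m \<Rightarrow>\<^sub>0 'a::comm_monoid_add"
  shows "f = (\<Sum>m\<in>Poly_Mapping.keys f. Poly_Mapping.single m (Poly_Mapping.lookup f m))"
proof (rule poly_mapping_eqI)
  fix k
  have "(\<Sum>m\<in>Poly_Mapping.keys f. Poly_Mapping.lookup (Poly_Mapping.single m (Poly_Mapping.lookup f m)) k)
      = (\<Sum>m\<in>Poly_Mapping.keys f. if m = k then Poly_Mapping.lookup f k else 0)"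
    by (intro sum.cong) (auto simp: lookup_single when_def)
  then show "Poly_Mapping.lookup f k
      = Poly_Mapping.lookup (\<Sum>m\<in>Poly_Mapping.keys f. Poly_Mapping.single m (Poly_Mapping.lookup f m)) k"
    by (simp add: lookup_sum in_keys_iff)
qed

lemma poly_mapping_induct [case_names single add]:
  fixes f :: "'m \<Rightarrow>\<^sub>0 'a::comm_monoid_add"
  assumes single: "\<And>m c. P (Poly_Mapping.single m c)" and add: "\<And>f g. P f \<Longrightarrow> P g \<Longrightarrow> P (f + g)"
  shows "P f"
proof -
  have "P (\<Sum>m\<in>S. Poly_Mapping.single m (Poly_Mapping.lookup f m))" if "finite S" for S
    using that
  proof induction
    case empty
    show ?case using single[of undefined 0] by simp
  next
    case (insert m S)
    then show ?case using single add by simp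
  qed
  then show ?thesis using poly_mapping_sum_singles[of f] by (metis finite_keys)
qed

text \<open>By biadditivity, multiplicativity only has to be checked on single terms. This one
  argument serves coefficient maps, evaluation and the substitution X = 0.\<close>

lemma poly_mapping_mult_hom:
  fixes h :: "('m::comm_monoid_add \<Rightarrow>\<^sub>0 'a::comm_ring_1) \<Rightarrow> 'b::comm_ring_1"
  assumes add: "\<And>f g. h (f + g) = h f + h g"
    and single: "\<And>m n c d. h (Poly_Mapping.single (m + n) (c * d)) =
      h (Poly_Mapping.single m c) * h (Poly_Mapping.single n d)"
  shows "h (f * g) = h f * h g"
proof (induction f rule: poly_mapping_induct)
  case (single m c)
  show ?case
    by (induction g rule: poly_mapping_induct)
      (simp_all add: mult_single assms distrib_left)
qed (simp add: add distrib_right)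

lemma lookup_map0:
  "h 0 = 0 \<Longrightarrow> Poly_Mapping.lookup (Poly_Mapping.map h f) m = h (Poly_Mapping.lookup f m)"
  by (simp add: Poly_Mapping.map.rep_eq when_def)

text \<open>It is instantiated twice: with \<open>to_fract\<close>, for inverting t, and with
  evaluation at t = 0, for passing to the fiber.\<close>

locale coeff_hom =
  fixes h :: "'a::comm_ring_1 \<Rightarrow> 'b::comm_ring_1"
  assumes hom_add: "h (a + b) = h a + h b" and hom_mult: "h (a * b) = h a * h b"
    and hom_one: "h 1 = 1"
begin

lemma hom_zero: "h 0 = 0"
  using hom_add[of 0 0] by simp

lemma map_add: "Poly_Mapping.map h (f + g) = Poly_Mapping.map h f + Poly_Mapping.map h g"
  by (rule poly_mapping_eqI) (simp add: lookup_map0 hom_zero lookup_add hom_add)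

lemma map_single0: "Poly_Mapping.map h (Poly_Mapping.single m c) = Poly_Mapping.single m (h c)"
  by (rule poly_mapping_eqI) (simp add: lookup_map0 hom_zero lookup_single when_def)

lemma map_zero: "Poly_Mapping.map h 0 = 0"
  by (rule poly_mapping_eqI) (simp add: lookup_map0 hom_zero)

lemma map_mult:
  fixes f g :: "('m::comm_monoid_add) \<Rightarrow>\<^sub>0 'a"
  shows "Poly_Mapping.map h (f * g) = Poly_Mapping.map h f * Poly_Mapping.map h g"
  by (rule poly_mapping_mult_hom) (simp_all add: map_add map_single0 mult_single hom_mult)

lemma map_one: "Poly_Mapping.map h (1 :: ('m::comm_monoid_add) \<Rightarrow>\<^sub>0 'a) = 1"
  using map_single0[of 0 1] by (simp add: hom_one)

lemma map_uminus: "Poly_Mapping.map h (- f) = - Poly_Mapping.map h f"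
  using map_add[of f "- f"] by (simp add: map_zero eq_neg_iff_add_eq_0 add.commute)

lemma map_diff: "Poly_Mapping.map h (f - g) = Poly_Mapping.map h f - Poly_Mapping.map h g"
  using map_add[of f "- g"] by (simp add: map_uminus)

lemma map_power:
  "Poly_Mapping.map h (f ^ n :: ('m::comm_monoid_add) \<Rightarrow>\<^sub>0 'a) = Poly_Mapping.map h f ^ n"
  by (induction n) (simp_all add: map_one map_mult)

lemma map_numeral:
  "Poly_Mapping.map h (numeral n :: ('m::comm_monoid_add) \<Rightarrow>\<^sub>0 'a) = numeral n"
proof -
  have "Poly_Mapping.map h (of_nat k :: 'm \<Rightarrow>\<^sub>0 'a) = of_nat k" for k
    by (induction k) (simp_all add: map_one map_add map_zero)
  from this[of "numeral n"] show ?thesis by simp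
qed

lemma map_hvar: "Poly_Mapping.map h (hvar i) = hvar i"
  unfolding hvar_def by (simp add: map_single0 hom_one)

lemma map_coeff_const: "Poly_Mapping.map h (coeff_const c) = coeff_const (h c)"
  unfolding coeff_const_def by (simp add: map_single0)

lemmas map_hom = map_add map_zero map_mult map_one map_uminus map_diff map_power map_numeral
  map_hvar map_coeff_const

end

lemma coeff_const_mult: "coeff_const (a * b) = coeff_const a * (coeff_const b :: 'a::comm_ring_1 poly3)"
  by (simp add: coeff_const_def mult_single)

lemma coeff_const_one [simp]: "coeff_const 1 = (1 :: 'a::comm_ring_1 poly3)"
  by (simp add: coeff_const_def)

lemma coeff_const_zero [simp]: "coeff_const 0 = (0 :: 'a::comm_ring_1 poly3)"
  by (simp add: coeff_const_def)

lemma coeff_const_power: "coeff_const (a ^ n) = (coeff_const a :: 'a::comm_ring_1 poly3) ^ n"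
  by (induction n) (simp_all add: coeff_const_mult)

lemma lookup_coeff_const_mult:
  "Poly_Mapping.lookup (coeff_const c * f) m = c * Poly_Mapping.lookup f m"
  for f :: "'a::comm_ring_1 poly3"
  unfolding coeff_const_def mult_map_scale_conv_mult[symmetric] by (simp add: lookup_map0)

lemma single_hvar_prod:
  "Poly_Mapping.single m c = coeff_const c * hvar 1 ^ Poly_Mapping.lookup m 1 *
     hvar 2 ^ Poly_Mapping.lookup m 2 * (hvar 3 ^ Poly_Mapping.lookup m 3 :: 'a::comm_ring_1 poly3)"
proof -
  have "m = Poly_Mapping.single 1 (Poly_Mapping.lookup m 1) +
      Poly_Mapping.single 2 (Poly_Mapping.lookup m 2) + Poly_Mapping.single 3 (Poly_Mapping.lookup m 3)"
  proof (rule poly_mapping_eqI)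
    fix i :: 3
    show "Poly_Mapping.lookup m i = Poly_Mapping.lookup (Poly_Mapping.single 1 (Poly_Mapping.lookup m 1) +
      Poly_Mapping.single 2 (Poly_Mapping.lookup m 2) + Poly_Mapping.single 3 (Poly_Mapping.lookup m 3)) i"
      using exhaust_3[of i] by (auto simp: lookup_add lookup_single when_def)
  qed
  then show ?thesis by (simp add: hvar_power coeff_const_def mult_single)
qed

subsection \<open>Evaluation\<close>

lemma eval3_eq_sum:
  assumes "finite S" "Poly_Mapping.keys f \<subseteq> S"
  shows "eval3 v f =
     (\<Sum>m\<in>S. Poly_Mapping.lookup f m * (\<Prod>i\<in>UNIV. (v $ i) ^ Poly_Mapping.lookup m i))"
  unfolding eval3_def using assms by (intro sum.mono_neutral_left) (auto simp: in_keys_iff)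

lemma eval3_add: "eval3 v (f + g) = eval3 v f + eval3 v g"
proof -
  define S where "S = Poly_Mapping.keys f \<union> Poly_Mapping.keys g"
  have "finite S" "Poly_Mapping.keys f \<subseteq> S" "Poly_Mapping.keys g \<subseteq> S" "Poly_Mapping.keys (f + g) \<subseteq> S"
    using keys_add[of f g] by (auto simp: S_def)
  then show ?thesis
    by (simp add: eval3_eq_sum[of S] lookup_add distrib_right sum.distrib)
qed

lemma eval3_single:
  "eval3 v (Poly_Mapping.single m c) = c * (\<Prod>i\<in>UNIV. (v $ i) ^ Poly_Mapping.lookup m i)"
  by (simp add: eval3_def)

lemma eval3_mult: "eval3 v (f * g) = eval3 v f * eval3 v g"
  by (rule poly_mapping_mult_hom)
    (simp_all add: eval3_add eval3_single lookup_add power_add prod.distrib mult_ac)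

lemma eval3_zero: "eval3 v 0 = 0"
  by (simp add: eval3_def)

lemma eval3_uminus: "eval3 v (- f) = - eval3 v f"
  using eval3_add[of v f "- f"] by (simp add: eval3_zero eq_neg_iff_add_eq_0 add.commute)

lemma eval3_diff: "eval3 v (f - g) = eval3 v f - eval3 v g"
  using eval3_add[of v f "- g"] by (simp add: eval3_uminus)

lemma eval3_coeff_const: "eval3 v (coeff_const c) = c"
  by (simp add: eval3_single coeff_const_def)

lemma eval3_one: "eval3 v 1 = 1"
  using eval3_coeff_const[of v 1] by simp

lemma eval3_power: "eval3 v (f ^ n) = eval3 v f ^ n"
  by (induction n) (simp_all add: eval3_one eval3_mult)

lemma eval3_numeral: "eval3 v (numeral n) = numeral n"
  using eval3_coeff_const[of v "numeral n"] by (simp add: coeff_const_def)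

lemma eval3_hvar: "eval3 v (hvar i) = v $ i"
proof -
  have "(\<Prod>j\<in>UNIV. (v $ j) ^ Poly_Mapping.lookup (Poly_Mapping.single i 1) j) = (\<Prod>j\<in>UNIV. if j = i then v $ i else 1)"
    by (intro prod.cong) (auto simp: lookup_single when_def)
  then show ?thesis by (simp add: hvar_def eval3_single)
qed

lemmas eval3_hom = eval3_add eval3_mult eval3_zero eval3_uminus eval3_diff eval3_coeff_const
  eval3_one eval3_power eval3_numeral eval3_hvar

subsection \<open>Homogeneous polynomials\<close>

abbreviation mdeg :: "(3 \<Rightarrow>\<^sub>0 nat) \<Rightarrow> nat" where
  "mdeg m \<equiv> (\<Sum>i\<in>UNIV. Poly_Mapping.lookup m i)"

lemma mdeg_add: "mdeg (m + n) = mdeg m + mdeg n"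
  by (simp add: lookup_add sum.distrib)

lemma homogeneous3_zero: "homogeneous3 d 0"
  by (simp add: homogeneous3_def)

lemma homogeneous3_add: "homogeneous3 d f \<Longrightarrow> homogeneous3 d g \<Longrightarrow> homogeneous3 d (f + g)"
  unfolding homogeneous3_def using keys_add[of f g] by blast

lemma homogeneous3_uminus: "homogeneous3 d f \<Longrightarrow> homogeneous3 d (- f :: 'a::comm_ring_1 poly3)"
  unfolding homogeneous3_def by (simp add: in_keys_iff)

lemma homogeneous3_diff:
  "homogeneous3 d f \<Longrightarrow> homogeneous3 d g \<Longrightarrow> homogeneous3 d (f - g :: 'a::comm_ring_1 poly3)"
  using homogeneous3_add[of d f "- g"] homogeneous3_uminus[of d g] by simp

lemma homogeneous3_mult:
  fixes f g :: "'a::comm_ring_1 poly3"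
  assumes "homogeneous3 d f" "homogeneous3 e g"
  shows "homogeneous3 (d + e) (f * g)"
  unfolding homogeneous3_def
proof
  fix m assume "m \<in> Poly_Mapping.keys (f * g)"
  then obtain a b where "a \<in> Poly_Mapping.keys f" "b \<in> Poly_Mapping.keys g" "m = a + b"
    using keys_mult[of f g] by blast
  then show "mdeg m = d + e" using assms by (simp add: homogeneous3_def mdeg_add)
qed

lemma homogeneous3_single: "mdeg m = d \<Longrightarrow> homogeneous3 d (Poly_Mapping.single m c)"
  by (simp add: homogeneous3_def)

lemma homogeneous3_coeff_const: "homogeneous3 0 (coeff_const c)"
  unfolding coeff_const_def by (intro homogeneous3_single) simp

lemma homogeneous3_numeral: "homogeneous3 0 (numeral n :: 'a::comm_ring_1 poly3)"
  using homogeneous3_coeff_const[of "numeral n :: 'a"] by (simp add: coeff_const_def)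

lemma homogeneous3_one: "homogeneous3 0 (1 :: 'a::comm_ring_1 poly3)"
  using homogeneous3_coeff_const[of "1 :: 'a"] by simp

lemma mdeg_single: "mdeg (Poly_Mapping.single i n) = n"
proof -
  have "mdeg (Poly_Mapping.single i n) = (\<Sum>j\<in>UNIV. if j = i then n else 0)"
    by (intro sum.cong) (auto simp: lookup_single when_def)
  then show ?thesis by simp
qed

lemma homogeneous3_hvar: "homogeneous3 1 (hvar i :: 'a::comm_ring_1 poly3)"
  unfolding hvar_def by (intro homogeneous3_single) (rule mdeg_single)

lemma homogeneous3_power:
  fixes f :: "'a::comm_ring_1 poly3"
  shows "homogeneous3 d f \<Longrightarrow> homogeneous3 (n * d) (f ^ n)"
  by (induction n) (auto simp: homogeneous3_one intro: homogeneous3_mult)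

lemma homogeneous3_mult':
  fixes f g :: "'a::comm_ring_1 poly3"
  shows "homogeneous3 d f \<Longrightarrow> homogeneous3 e g \<Longrightarrow> k = d + e \<Longrightarrow> homogeneous3 k (f * g)"
  using homogeneous3_mult by blast

lemma homogeneous3_power':
  fixes f :: "'a::comm_ring_1 poly3"
  shows "homogeneous3 d f \<Longrightarrow> k = n * d \<Longrightarrow> homogeneous3 k (f ^ n)"
  using homogeneous3_power by blast

section \<open>Homogeneous components\<close>

definition hpart :: "nat \<Rightarrow> 'a::comm_ring_1 poly3 \<Rightarrow> 'a poly3" where
  "hpart d f = Poly_Mapping.mapp (\<lambda>m c. c when mdeg m = d) f"

lemma lookup_hpart: "Poly_Mapping.lookup (hpart d f) m = (Poly_Mapping.lookup f m when mdeg m = d)"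
  by (simp add: hpart_def lookup_mapp when_def in_keys_iff)

lemma hpart_add: "hpart d (f + g) = hpart d f + hpart d g"
  by (rule poly_mapping_eqI) (simp add: lookup_hpart lookup_add when_def)

lemma homogeneous3_hpart: "homogeneous3 d (hpart d f)"
  unfolding homogeneous3_def by (auto simp: in_keys_iff lookup_hpart when_def split: if_splits)

lemma hpart_homogeneous: "homogeneous3 e f \<Longrightarrow> hpart d f = (if d = e then f else 0)"
  by (rule poly_mapping_eqI) (auto simp: lookup_hpart when_def homogeneous3_def in_keys_iff)

lemma hpart_mult:
  fixes f g :: "'a::comm_ring_1 poly3"
  assumes "homogeneous3 e g"
  shows "hpart d (f * g) = (if e \<le> d then hpart (d - e) f * g else 0)"
proof (induction f rule: poly_mapping_induct)
  case (single m c)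
  have m: "homogeneous3 (mdeg m) (Poly_Mapping.single m c)" by (simp add: homogeneous3_single)
  show ?case
    by (auto simp: hpart_homogeneous[OF homogeneous3_mult[OF m assms]] hpart_homogeneous[OF m])
next
  case (add f f')
  then show ?case by (simp add: distrib_right hpart_add)
qed

subsection \<open>Divisibility by the first variable\<close>

text \<open>This is the substitution X = 0, kept inside the ring in three variables.\<close>

definition drop_X :: "'a::comm_ring_1 poly3 \<Rightarrow> 'a poly3" where
  "drop_X f = Poly_Mapping.mapp (\<lambda>m c. c when Poly_Mapping.lookup m 1 = 0) f"

lemma lookup_drop_X:
  "Poly_Mapping.lookup (drop_X f) m = (Poly_Mapping.lookup f m when Poly_Mapping.lookup m 1 = 0)"
  by (simp add: drop_X_def lookup_mapp when_def in_keys_iff)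

lemma drop_X_mult: "drop_X (f * g) = drop_X f * drop_X g"
proof (rule poly_mapping_mult_hom)
  show "drop_X (f + g) = drop_X f + drop_X g" for f g :: "'a poly3"
    by (rule poly_mapping_eqI) (simp add: lookup_drop_X lookup_add when_def)
  have "drop_X (Poly_Mapping.single m c) = (Poly_Mapping.single m c when Poly_Mapping.lookup m 1 = 0)"
    for m and c :: 'a
    by (rule poly_mapping_eqI) (auto simp: lookup_drop_X lookup_single when_def)
  then show "drop_X (Poly_Mapping.single (m + n) (c * d)) =
      drop_X (Poly_Mapping.single m c) * drop_X (Poly_Mapping.single n d)" for m n and c d :: 'a
    by (auto simp: lookup_add when_def mult_single)
qed

lemma hvar_1_dvd_iff: "hvar 1 dvd f \<longleftrightarrow> drop_X f = 0"
proof
  have "drop_X (hvar 1 :: 'a poly3) = 0"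
    by (rule poly_mapping_eqI) (auto simp: lookup_drop_X hvar_def lookup_single when_def)
  then show "hvar 1 dvd f \<Longrightarrow> drop_X f = 0" by (auto simp: dvd_def drop_X_mult)
next
  assume f: "drop_X f = 0"
  have "hvar 1 dvd Poly_Mapping.single m (Poly_Mapping.lookup f m)" if "m \<in> Poly_Mapping.keys f" for m
  proof -
    have "Poly_Mapping.lookup (drop_X f) m = 0" using f by simp
    then have "Poly_Mapping.lookup m 1 \<noteq> 0"
      using that by (auto simp: lookup_drop_X in_keys_iff when_def split: if_splits)
    then have "hvar 1 dvd (hvar 1 :: 'a poly3) ^ Poly_Mapping.lookup m 1" by (simp add: dvd_power)
    then show ?thesis unfolding single_hvar_prod[of m] by simp
  qed
  then show "hvar 1 dvd f" using poly_mapping_sum_singles[of f] by (metis dvd_sum)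
qed

text \<open>X is prime: it generates the kernel of the ring homomorphism \<open>drop_X\<close>,
  whose values lie in a domain.\<close>

lemma hvar_1_dvd_mult_iff:
  fixes f g :: "'a::idom poly3"
  shows "hvar 1 dvd f * g \<longleftrightarrow> hvar 1 dvd f \<or> hvar 1 dvd g"
  unfolding hvar_1_dvd_iff drop_X_mult by simp

lemma hvar_nonzero: "(hvar i :: 'a::comm_ring_1 poly3) \<noteq> 0"
  unfolding hvar_def by (metis lookup_single_eq lookup_zero zero_neq_one)

lemma eval3_0_if_hvar_1_dvd: "hvar 1 dvd f \<Longrightarrow> v $ 1 = 0 \<Longrightarrow> eval3 v f = 0"
  by (auto simp: dvd_def eval3_hom)

subsection \<open>Partial derivatives\<close>

lemma pderiv3_eq_sum:
  assumes "finite S" "Poly_Mapping.keys f \<subseteq> S"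
  shows "pderiv3 i f = (\<Sum>m\<in>S. Poly_Mapping.single (m - Poly_Mapping.single i 1)
          (of_nat (Poly_Mapping.lookup m i) * Poly_Mapping.lookup f m))"
  unfolding pderiv3_def using assms by (intro sum.mono_neutral_left) (auto simp: in_keys_iff)

lemma pderiv3_add: "pderiv3 i (f + g) = pderiv3 i f + pderiv3 i g"
proof -
  define S where "S = Poly_Mapping.keys f \<union> Poly_Mapping.keys g"
  have "finite S" "Poly_Mapping.keys f \<subseteq> S" "Poly_Mapping.keys g \<subseteq> S" "Poly_Mapping.keys (f + g) \<subseteq> S"
    using keys_add[of f g] by (auto simp: S_def)
  then show ?thesis
    by (simp add: pderiv3_eq_sum[of S] lookup_add distrib_left sum.distrib single_add)
qed

lemma pderiv3_single:
  "pderiv3 i (Poly_Mapping.single m c) =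
     Poly_Mapping.single (m - Poly_Mapping.single i 1) (of_nat (Poly_Mapping.lookup m i) * c)"
  by (simp add: pderiv3_def)

lemma pderiv3_mult: "pderiv3 i (f * g) = pderiv3 i f * g + f * pderiv3 i g"
proof (induction f rule: poly_mapping_induct)
  case (single m c)
  show ?case
  proof (induction g rule: poly_mapping_induct)
    case (single n d)
    \<comment> \<open>Exponents are subtracted in the natural numbers, so the two sides can have
      different exponents when \<open>lookup a i\<close> is 0; the factor \<open>of_nat 0\<close>
      then kills both.\<close>
    have shift: "Poly_Mapping.single (a - Poly_Mapping.single i 1 + b)
          (of_nat (Poly_Mapping.lookup a i) * r) =
        Poly_Mapping.single (a + b - Poly_Mapping.single i 1) (of_nat (Poly_Mapping.lookup a i) * r)"
      for a b and r :: 'a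
    proof (cases "Poly_Mapping.lookup a i")
      case (Suc k)
      then have "a - Poly_Mapping.single i 1 + b = a + b - Poly_Mapping.single i 1"
        by (intro poly_mapping_eqI) (auto simp: lookup_add lookup_minus lookup_single when_def)
      then show ?thesis by simp
    qed simp
    show ?case
      using shift[of m n "c * d"] shift[of n m "c * d"]
      by (simp add: mult_single pderiv3_single lookup_add distrib_right distrib_left single_add add.commute mult_ac)
  qed (simp add: distrib_left pderiv3_add)
qed (simp add: distrib_right pderiv3_add)

lemma pderiv3_coeff_const: "pderiv3 i (coeff_const c) = 0"
  by (simp add: coeff_const_def pderiv3_single)

lemma pderiv3_coeff_const_mult: "pderiv3 i (coeff_const c * f) = coeff_const c * pderiv3 i f"
  by (simp add: pderiv3_mult pderiv3_coeff_const)

lemma pderiv3_numeral: "pderiv3 i (numeral n) = 0"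
  using pderiv3_coeff_const[of i "numeral n"] by (simp add: coeff_const_def)

lemma pderiv3_one: "pderiv3 i 1 = 0"
  using pderiv3_coeff_const[of i 1] by simp

lemma pderiv3_zero: "pderiv3 i 0 = 0"
  using pderiv3_coeff_const[of i 0] by simp

lemma pderiv3_uminus: "pderiv3 i (- f) = - pderiv3 i f"
  using pderiv3_add[of i f "- f"] by (simp add: pderiv3_zero eq_neg_iff_add_eq_0 add.commute)

lemma pderiv3_diff: "pderiv3 i (f - g) = pderiv3 i f - pderiv3 i g"
  using pderiv3_add[of i f "- g"] by (simp add: pderiv3_uminus)

lemma pderiv3_hvar: "pderiv3 i (hvar j) = (if i = j then 1 else 0)"
  by (auto simp: hvar_def pderiv3_single lookup_single when_def)

lemma pderiv3_power: "pderiv3 i (f ^ Suc n) = of_nat (Suc n) * f ^ n * pderiv3 i f"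
  by (induction n) (simp_all add: pderiv3_mult algebra_simps)

lemma pderiv3_power_numeral:
  "pderiv3 i (f ^ numeral n) = numeral n * f ^ (pred_numeral n) * pderiv3 i f"
  using pderiv3_power[of i f "pred_numeral n"] unfolding numeral_eq_Suc[symmetric]
  by (simp only: of_nat_numeral)

lemma homogeneous3_sum:
  "(\<And>m. m \<in> S \<Longrightarrow> homogeneous3 d (f m)) \<Longrightarrow> homogeneous3 d (\<Sum>m\<in>S. f m)"
  by (induction S rule: infinite_finite_induct) (auto simp: homogeneous3_zero homogeneous3_add)

lemma homogeneous3_pderiv3:
  assumes "homogeneous3 (Suc d) f"
  shows "homogeneous3 d (pderiv3 i f)"
  unfolding pderiv3_def
proof (rule homogeneous3_sum)
  fix m assume m: "m \<in> Poly_Mapping.keys f"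
  show "homogeneous3 d (Poly_Mapping.single (m - Poly_Mapping.single i 1)
          (of_nat (Poly_Mapping.lookup m i) * Poly_Mapping.lookup f m))"
  proof (cases "Poly_Mapping.lookup m i")
    case (Suc k)
    then have "m = (m - Poly_Mapping.single i 1) + Poly_Mapping.single i 1"
      by (intro poly_mapping_eqI) (auto simp: lookup_add lookup_minus lookup_single when_def)
    then have "mdeg m = mdeg (m - Poly_Mapping.single i 1) + 1"
      using mdeg_add mdeg_single by metis
    then show ?thesis using assms m by (intro homogeneous3_single) (simp add: homogeneous3_def)
  qed (simp add: homogeneous3_zero)
qed

section \<open>The closure of the flex scheme\<close>

context type_subring
begin

lemma sum_closed: "(\<And>i. i \<in> S \<Longrightarrow> f i \<in> R) \<Longrightarrow> sum f S \<in> R"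
  by (induction S rule: infinite_finite_induct) auto

lemma type_subring_poly_mapping:
  "type_subring {f :: 'm::comm_monoid_add \<Rightarrow>\<^sub>0 'a. \<forall>m. Poly_Mapping.lookup f m \<in> R}"
proof unfold_locales
  fix f g :: "'m \<Rightarrow>\<^sub>0 'a"
  assume f: "f \<in> {f. \<forall>m. Poly_Mapping.lookup f m \<in> R}" and g: "g \<in> {f. \<forall>m. Poly_Mapping.lookup f m \<in> R}"
  show "f * g \<in> {f. \<forall>m. Poly_Mapping.lookup f m \<in> R}"
  proof (intro CollectI allI)
    fix k
    have "f * g = (\<Sum>m\<in>Poly_Mapping.keys f. Poly_Mapping.single m (Poly_Mapping.lookup f m)) *
        (\<Sum>n\<in>Poly_Mapping.keys g. Poly_Mapping.single n (Poly_Mapping.lookup g n))"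
      by (simp only: poly_mapping_sum_singles[symmetric])
    then have "Poly_Mapping.lookup (f * g) k =
        (\<Sum>m\<in>Poly_Mapping.keys f. \<Sum>n\<in>Poly_Mapping.keys g.
           Poly_Mapping.lookup (Poly_Mapping.single (m + n) (Poly_Mapping.lookup f m * Poly_Mapping.lookup g n)) k)"
      by (simp add: sum_product mult_single lookup_sum)
    also have "\<dots> \<in> R" using f g by (intro sum_closed) (auto simp: lookup_single when_def)
    finally show "Poly_Mapping.lookup (f * g) k \<in> R" .
  qed
qed (auto simp: lookup_add lookup_one when_def)

end

lemma type_subring_laurent_ring: "type_subring laurent_ring"
proof
  have pow_nz: "[:0, 1:] ^ k \<noteq> (0 :: complex poly)" for k by simp
  have I: "u \<in> laurent_ring" if "u = Fraction_Field.Fract p ([:0, 1:] ^ k)" for u p k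
    using that unfolding laurent_ring_def by blast
  show "0 \<in> laurent_ring" by (rule I[of _ 0 0]) (simp add: Zero_fract_def)
  show "1 \<in> laurent_ring" by (rule I[of _ 1 0]) (simp add: One_fract_def)
  fix a b assume "a \<in> laurent_ring" "b \<in> laurent_ring"
  then obtain p k q l where ab: "a = Fraction_Field.Fract p ([:0, 1:] ^ k)"
    "b = Fraction_Field.Fract q ([:0, 1:] ^ l)"
    unfolding laurent_ring_def by blast
  show "a + b \<in> laurent_ring"
    by (rule I[of _ "p * [:0, 1:] ^ l + q * [:0, 1:] ^ k" "k + l"])
      (use pow_nz in \<open>simp add: ab add_fract power_add\<close>)
  show "- a \<in> laurent_ring" by (rule I[of _ "- p" k]) (simp add: ab)
  show "a * b \<in> laurent_ring"
    by (rule I[of _ "p * q" "k + l"]) (simp add: ab power_add)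
qed

interpretation to_fract: coeff_hom "to_fract :: 'a::idom \<Rightarrow> 'a fract"
  by unfold_locales (simp_all add: to_fract_def One_fract_def)

lemma map_to_fract_inject:
  "Poly_Mapping.map to_fract f = Poly_Mapping.map to_fract g \<longleftrightarrow> f = g"
proof
  assume eq: "Poly_Mapping.map to_fract f = Poly_Mapping.map to_fract g"
  show "f = g"
  proof (rule poly_mapping_eqI)
    fix m
    have "Poly_Mapping.lookup (Poly_Mapping.map to_fract f) m = Poly_Mapping.lookup (Poly_Mapping.map to_fract g) m"
      using eq by simp
    then show "Poly_Mapping.lookup f m = Poly_Mapping.lookup g m"
      by (simp add: lookup_map0 to_fract_eq_iff)
  qed
qed simp

abbreviation tvar :: "complex poly poly3" where
  "tvar \<equiv> coeff_const [:0, 1:]"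

lemma tvar_nonzero: "tvar \<noteq> 0"
  unfolding coeff_const_def by (metis lookup_single_eq lookup_zero pCons_eq_0_iff zero_neq_one)

text \<open>The finitely many coefficients have a common denominator t^k.\<close>

lemma clear_laurent_denominators:
  assumes "\<forall>m. Poly_Mapping.lookup r m \<in> laurent_ring"
  shows "\<exists>k r'. Poly_Mapping.map to_fract (tvar ^ k) * r = Poly_Mapping.map to_fract r'"
proof -
  have "\<exists>k r'. Poly_Mapping.map to_fract (tvar ^ k) *
      (\<Sum>m\<in>S. Poly_Mapping.single m (Poly_Mapping.lookup r m)) = Poly_Mapping.map to_fract r'"
    if "finite S" for S
    using that
  proof induction
    case empty
    show ?case by (intro exI[of _ 0]) (simp add: to_fract.map_zero)
  next
    case (insert m S)
    then obtain k r' where IH: "Poly_Mapping.map to_fract (tvar ^ k) *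
      (\<Sum>m\<in>S. Poly_Mapping.single m (Poly_Mapping.lookup r m)) = Poly_Mapping.map to_fract r'"
      by blast
    obtain p l where pl: "Poly_Mapping.lookup r m = Fraction_Field.Fract p ([:0, 1:] ^ l)"
      using assms unfolding laurent_ring_def by blast
    have "to_fract ([:0, 1:] ^ l) * Poly_Mapping.lookup r m = to_fract p"
      unfolding pl to_fract_def by (simp add: eq_fract)
    then have "Poly_Mapping.map to_fract (tvar ^ l) * Poly_Mapping.single m (Poly_Mapping.lookup r m)
        = Poly_Mapping.map to_fract (Poly_Mapping.single m p)"
      by (simp add: coeff_const_power[symmetric] to_fract.map_coeff_const to_fract.map_single0)
        (simp add: coeff_const_def mult_single)
    then have "Poly_Mapping.map to_fract (tvar ^ (k + l)) *
        (\<Sum>m\<in>insert m S. Poly_Mapping.single m (Poly_Mapping.lookup r m)) =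
        Poly_Mapping.map to_fract (tvar ^ k * Poly_Mapping.single m p + tvar ^ l * r')"
      using insert.hyps IH by (simp add: power_add to_fract.map_hom algebra_simps)
    then show ?case by blast
  qed
  from this[of "Poly_Mapping.keys r"] show ?thesis
    by (simp add: poly_mapping_sum_singles[symmetric])
qed

lemma poly3_ring_UNIV: "poly3_ring UNIV = ring_of_type_algebra\<lparr>carrier := UNIV\<rparr>"
  by (simp add: poly3_ring_def)

lemma flex_ideal_eq: "flex_ideal f = {a * f + b * hessian f | a b. True}"
proof -
  interpret type_subring "UNIV :: complex poly poly3 set" by (rule type_subring_UNIV)
  have "genideal Rng (set [f, hessian f]) = idl [f, hessian f]"
    by (rule genideal_set_eq_idl) simp
  moreover have "idl [f, hessian f] = {a * f + b * hessian f | a b. True}"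
    unfolding set_eq_iff idl2_iff by simp
  ultimately show ?thesis
    unfolding flex_ideal_def poly3_ring_UNIV by (simp only: list.set)
qed

text \<open>Extension to Laurent coefficients followed by contraction is saturation with respect to
  t. The closure can then be handled inside the polynomial ring over C[t].\<close>

lemma flex_ideal_closure_iff: "g \<in> flex_ideal_closure f \<longleftrightarrow> (\<exists>k. tvar ^ k * g \<in> flex_ideal f)"
proof -
  interpret L: type_subring "{u :: complex poly fract poly3. \<forall>m. Poly_Mapping.lookup u m \<in> laurent_ring}"
    by (rule type_subring.type_subring_poly_mapping[OF type_subring_laurent_ring])
  let ?i = "Poly_Mapping.map to_fract :: complex poly poly3 \<Rightarrow> complex poly fract poly3"
  let ?C = "{u :: complex poly fract poly3. \<forall>m. Poly_Mapping.lookup u m \<in> laurent_ring}"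
  have "to_fract p \<in> laurent_ring" for p
    unfolding laurent_ring_def by (intro CollectI exI[of _ p] exI[of _ 0]) (simp add: to_fract_def)
  then have i_C: "?i h \<in> ?C" for h by (simp add: lookup_map0)
  have FI_add: "a + b \<in> flex_ideal f" if "a \<in> flex_ideal f" "b \<in> flex_ideal f" for a b
  proof -
    from that obtain p q p' q' where "a = p * f + q * hessian f" "b = p' * f + q' * hessian f"
      unfolding flex_ideal_eq by blast
    then have "a + b = (p + p') * f + (q + q') * hessian f" by (simp add: algebra_simps)
    then show ?thesis unfolding flex_ideal_eq by blast
  qed
  have FI_mult: "c * a \<in> flex_ideal f" if a: "a \<in> flex_ideal f" for a c
  proof -
    from a obtain p q where "a = p * f + q * hessian f"
      unfolding flex_ideal_eq by blast
    then have "c * a = (c * p) * f + (c * q) * hessian f" by (simp add: algebra_simps)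
    then show ?thesis unfolding flex_ideal_eq by blast
  qed
  have P: "flex_ideal_punctured f = genideal L.Rng (?i ` flex_ideal f)"
    by (simp add: flex_ideal_punctured_def poly3_ring_def)
  \<comment> \<open>\<open>A\<close> consists of the elements that a power of t carries into the
    flex ideal. It is an ideal containing the generators, so it contains the extended ideal.\<close>
  define A where "A = {u \<in> ?C. \<exists>k g'. g' \<in> flex_ideal f \<and> ?i (tvar ^ k) * u = ?i g'}"
  have AI: "u \<in> A" if "?i (tvar ^ k) * u = ?i g'" "u \<in> ?C" "g' \<in> flex_ideal f" for u k g'
    unfolding A_def using that by blast
  have "L.is_ideal A"
    unfolding L.is_ideal_def
  proof (intro conjI ballI)
    show "A \<subseteq> ?C" by (auto simp: A_def)
    have "0 \<in> flex_ideal f" unfolding flex_ideal_eq by (auto intro!: exI[of _ 0])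
    then show "0 \<in> A" by (intro AI[OF _ L.zero_closed, of 0 0]) (simp_all add: to_fract.map_zero)
  next
    fix a b assume "a \<in> A" "b \<in> A"
    then obtain k p l q where kl: "a \<in> ?C" "b \<in> ?C" "p \<in> flex_ideal f" "?i (tvar ^ k) * a = ?i p"
      "q \<in> flex_ideal f" "?i (tvar ^ l) * b = ?i q"
      unfolding A_def by blast
    have "?i (tvar ^ (k + l)) * (a + b) = ?i (tvar ^ l) * (?i (tvar ^ k) * a) + ?i (tvar ^ k) * (?i (tvar ^ l) * b)"
      by (simp add: power_add to_fract.map_hom algebra_simps)
    also have "\<dots> = ?i (tvar ^ l * p + tvar ^ k * q)" unfolding kl by (simp add: to_fract.map_hom)
    finally show "a + b \<in> A"
      by (rule AI[OF _ L.add_closed[OF kl(1,2)] FI_add[OF FI_mult[OF kl(3)] FI_mult[OF kl(5)]]])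
  next
    fix a r assume "a \<in> A" "r \<in> ?C"
    then obtain k p where kp: "a \<in> ?C" "p \<in> flex_ideal f" "?i (tvar ^ k) * a = ?i p"
      unfolding A_def by blast
    obtain l r' where l: "?i (tvar ^ l) * r = ?i r'"
      using clear_laurent_denominators \<open>r \<in> ?C\<close> by blast
    have "?i (tvar ^ (l + k)) * (r * a) = (?i (tvar ^ l) * r) * (?i (tvar ^ k) * a)"
      by (simp add: power_add to_fract.map_hom algebra_simps)
    also have "\<dots> = ?i (r' * p)" unfolding kp l by (simp add: to_fract.map_hom)
    finally show "r * a \<in> A"
      by (rule AI[OF _ L.mult_closed[OF \<open>r \<in> ?C\<close> kp(1)] FI_mult[OF kp(2)]])
  qed
  moreover have "?i ` flex_ideal f \<subseteq> A"
  proof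
    fix u assume "u \<in> ?i ` flex_ideal f"
    then obtain g' where "g' \<in> flex_ideal f" "u = ?i g'" by blast
    then show "u \<in> A" using i_C by (intro AI[of 0 _ g']) (simp_all add: to_fract.map_one)
  qed
  ultimately have sub: "flex_ideal_punctured f \<subseteq> A"
    unfolding P by (rule L.genideal_subset_ideal)
  show ?thesis
  proof
    assume "g \<in> flex_ideal_closure f"
    then have "?i g \<in> A" using sub unfolding flex_ideal_closure_def by blast
    then obtain k g' where "g' \<in> flex_ideal f" "?i (tvar ^ k * g) = ?i g'"
      unfolding A_def by (auto simp: to_fract.map_mult)
    then show "\<exists>k. tvar ^ k * g \<in> flex_ideal f" unfolding map_to_fract_inject by blast
  next
    assume "\<exists>k. tvar ^ k * g \<in> flex_ideal f"
    then obtain k where k: "tvar ^ k * g \<in> flex_ideal f" by blast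
    \<comment> \<open>The constant t^(-k), which is available over the Laurent ring.\<close>
    define c where "c = (coeff_const (Fraction_Field.Fract 1 ([:0, 1:] ^ k)) :: complex poly fract poly3)"
    have "0 \<in> laurent_ring" by (rule type_subring.zero_closed[OF type_subring_laurent_ring])
    then have "c \<in> ?C"
      unfolding c_def coeff_const_def by (auto simp: lookup_single when_def) (auto simp: laurent_ring_def)
    have "?i (tvar ^ k * g) \<in> flex_ideal_punctured f"
      unfolding P using L.genideal_superset k by blast
    moreover have "L.is_ideal (flex_ideal_punctured f)"
      unfolding P using i_C by (intro L.is_ideal_genideal) blast
    ultimately have "c * ?i (tvar ^ k * g) \<in> flex_ideal_punctured f"
      using L.is_idealD(4) \<open>c \<in> ?C\<close> by blast
    moreover have "c * ?i (tvar ^ k * g) = ?i g"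
    proof -
      have inv: "Fraction_Field.Fract 1 ([:0, 1:] ^ k) * to_fract ([:0, 1:] ^ k :: complex poly) = 1"
        by (simp add: to_fract_def One_fract_def eq_fract)
      have "c * ?i (tvar ^ k) = 1"
        unfolding c_def coeff_const_power[symmetric] to_fract.map_coeff_const coeff_const_mult[symmetric]
        by (simp only: inv coeff_const_one)
      then show ?thesis by (simp add: to_fract.map_mult mult.assoc[symmetric])
    qed
    ultimately show "g \<in> flex_ideal_closure f" unfolding flex_ideal_closure_def by simp
  qed
qed

section \<open>Restriction to t = 0\<close>

interpretation fiber0: coeff_hom "\<lambda>p :: complex poly. poly p 0"
  by unfold_locales simp_all

lemma fiber0_hom:
  "fiber0 (f + g) = fiber0 f + fiber0 g" "fiber0 0 = 0" "fiber0 (f * g) = fiber0 f * fiber0 g"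
  "fiber0 1 = 1" "fiber0 (- f) = - fiber0 f" "fiber0 (f - g) = fiber0 f - fiber0 g"
  "fiber0 (f ^ n) = fiber0 f ^ n" "fiber0 (numeral k) = numeral k" "fiber0 (hvar i) = hvar i"
  "fiber0 (coeff_const c) = coeff_const (poly c 0)"
  unfolding fiber0_def by (rule fiber0.map_hom)+

text \<open>Complex coefficients are read as constants in t; this is how coefficients of syzygies
  are lifted from the fiber.\<close>

lemma fiber0_surj: "\<exists>g. fiber0 g = f"
proof
  show "fiber0 (Poly_Mapping.map (\<lambda>c. [:c:]) f) = f"
    by (rule poly_mapping_eqI) (simp add: fiber0_def lookup_map0)
qed

lemma fiber0_tvar: "fiber0 tvar = 0"
  by (simp add: fiber0_hom)

lemma fiber0_eq_0D:
  assumes "fiber0 f = 0"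
  shows "\<exists>g. f = tvar * g"
proof
  show "f = tvar * Poly_Mapping.map (\<lambda>p. p div [:0, 1:]) f"
  proof (rule poly_mapping_eqI)
    fix m
    have "Poly_Mapping.lookup (fiber0 f) m = 0" using assms by simp
    then have "poly (Poly_Mapping.lookup f m) 0 = 0" by (simp add: fiber0_def lookup_map0)
    then have "[:0, 1:] dvd Poly_Mapping.lookup f m" by (simp add: poly_eq_0_iff_dvd)
    then show "Poly_Mapping.lookup f m =
        Poly_Mapping.lookup (tvar * Poly_Mapping.map (\<lambda>p. p div [:0, 1:]) f) m"
      unfolding lookup_coeff_const_mult by (subst lookup_map0) (simp_all only: div_0 dvd_mult_div_cancel)
  qed
qed

section \<open>The family of quartics\<close>

text \<open>The cofactor of the (1,1) entry of the Hessian matrix. The mixed derivatives are kept in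
  both orders, as they occur in \<open>det_3\<close>.\<close>

definition minor_YZ :: "'a::comm_ring_1 poly3 \<Rightarrow> 'a poly3" where
  "minor_YZ f = pderiv3 2 (pderiv3 2 f) * pderiv3 3 (pderiv3 3 f)
     - pderiv3 2 (pderiv3 3 f) * pderiv3 3 (pderiv3 2 f)"

lemma three_distinct: "(1::3) \<noteq> 2" "(1::3) \<noteq> 3" "(2::3) \<noteq> 1" "(2::3) \<noteq> 3" "(3::3) \<noteq> 1" "(3::3) \<noteq> 2"
  by simp_all

text \<open>The Hessian matrix is c times that of g, plus 12 X^2 in the (1,1) entry. Expanding the
  determinant linearly in that entry gives the term c^3 Hess(g) and the term 12 X^2 c^2 times the
  cofactor.\<close>

lemma hessian_pencil:
  "hessian (hvar 1 ^ 4 + coeff_const c * g) =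
     coeff_const c ^ 2 * (12 * hvar 1 ^ 2 * minor_YZ g + coeff_const c * hessian g)"
proof -
  have "pderiv3 i (pderiv3 j (hvar 1 ^ 4 + coeff_const c * g)) =
      (if i = 1 \<and> j = 1 then 12 * hvar 1 ^ 2 else 0) + coeff_const c * pderiv3 i (pderiv3 j g)" for i j
    by (simp add: pderiv3_add pderiv3_coeff_const_mult pderiv3_mult pderiv3_power_numeral pderiv3_hvar
        pderiv3_numeral pderiv3_zero pderiv3_one pderiv3_coeff_const power2_eq_square power3_eq_cube)
  then show ?thesis
    unfolding hessian_def minor_YZ_def det_3
    by (simp add: three_distinct power2_eq_square algebra_simps)
qed

lemma homogeneous3_minor_YZ:
  assumes "homogeneous3 (Suc (Suc d)) f"
  shows "homogeneous3 (d + d) (minor_YZ f)"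
  unfolding minor_YZ_def
  by (intro homogeneous3_diff homogeneous3_mult homogeneous3_pderiv3 assms)

lemma homogeneous3_hessian:
  assumes "homogeneous3 (Suc (Suc d)) f"
  shows "homogeneous3 (d + d + d) (hessian f)"
  unfolding hessian_def det_3
  by (simp, intro homogeneous3_diff homogeneous3_add homogeneous3_mult homogeneous3_pderiv3 assms)

text \<open>The polynomials \<open>G\<close>, \<open>12 D\<close>, \<open>E\<close>, \<open>P\<close> over \<open>t = 0\<close>.\<close>

definition G0 :: "complex poly3" where "G0 = fiber0 quartic_G"
definition Q0 :: "complex poly3" where "Q0 = 12 * fiber0 (minor_YZ quartic_G)"
definition E0 :: "complex poly3" where "E0 = fiber0 (hessian quartic_G)"
definition P0 :: "complex poly3" where "P0 = hvar 1 ^ 2 * E0 - G0 * Q0"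

lemma homogeneous3_quartic_G: "homogeneous3 4 quartic_G"
  unfolding quartic_G_def Let_def
  by (intro homogeneous3_add homogeneous3_diff;
      (rule homogeneous3_mult' homogeneous3_power' homogeneous3_numeral homogeneous3_hvar | simp)+)

text \<open>\<open>D1\<close> and \<open>G1\<close> are the quotients by X of D + 81 Y^4 and of G -
  3 Y^3 (Y + Z). They collect the part of each form that vanishes on the line X = 0.\<close>

definition D1 :: "'a::comm_ring_1 poly3" where
  "D1 = 216 * hvar 1 ^ 2 * hvar 2 - 108 * hvar 1 ^ 3
       - 324 * hvar 1 ^ 2 * hvar 3 + 108 * hvar 1 * hvar 2 ^ 2 + 216 * hvar 1 * hvar 2 * hvar 3
       - 216 * hvar 1 * hvar 3 ^ 2 - 216 * hvar 2 ^ 3 + 216 * hvar 2 ^ 2 * hvar 3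
       + 108 * hvar 2 * hvar 3 ^ 2"

definition G1 :: "'a::comm_ring_1 poly3" where
  "G1 = hvar 1 ^ 3 - 3 * hvar 1 ^ 2 * hvar 2 + 6 * hvar 1 ^ 2 * hvar 3
       - 3 * hvar 1 * hvar 2 ^ 2 - 6 * hvar 1 * hvar 2 * hvar 3 + 6 * hvar 1 * hvar 3 ^ 2
       + 4 * hvar 2 ^ 3 - 6 * hvar 2 ^ 2 * hvar 3 - 6 * hvar 2 * hvar 3 ^ 2 + hvar 3 ^ 3"

lemma quartic_G_eq: "quartic_G = hvar 1 * G1 + 3 * hvar 2 ^ 3 * (hvar 2 + hvar 3)"
  unfolding quartic_G_def Let_def G1_def
  by (simp add: algebra_simps power2_eq_square power3_eq_cube power4_eq_xxxx)

lemma minor_YZ_quartic_G: "minor_YZ quartic_G = hvar 1 * D1 - 81 * hvar 2 ^ 4"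
proof -
  note derivs = pderiv3_add pderiv3_diff pderiv3_mult pderiv3_power_numeral pderiv3_hvar
    pderiv3_numeral pderiv3_zero pderiv3_one three_distinct
  have y: "pderiv3 2 quartic_G = - 3 * hvar 1 ^ 3 - 6 * hvar 1 ^ 2 * hvar 2 - 6 * hvar 1 ^ 2 * hvar 3
      + 12 * hvar 1 * hvar 2 ^ 2 - 12 * hvar 1 * hvar 2 * hvar 3 - 6 * hvar 1 * hvar 3 ^ 2
      + 12 * hvar 2 ^ 3 + 9 * hvar 2 ^ 2 * hvar 3"
    unfolding quartic_G_def Let_def by (simp add: derivs, algebra)
  have z: "pderiv3 3 quartic_G = 6 * hvar 1 ^ 3 - 6 * hvar 1 ^ 2 * hvar 2 + 12 * hvar 1 ^ 2 * hvar 3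
      - 6 * hvar 1 * hvar 2 ^ 2 - 12 * hvar 1 * hvar 2 * hvar 3 + 3 * hvar 1 * hvar 3 ^ 2
      + 3 * hvar 2 ^ 3"
    unfolding quartic_G_def Let_def by (simp add: derivs, algebra)
  have yy: "pderiv3 2 (pderiv3 2 quartic_G) = - 6 * hvar 1 ^ 2 + 24 * hvar 1 * hvar 2
      - 12 * hvar 1 * hvar 3 + 36 * hvar 2 ^ 2 + 18 * hvar 2 * hvar 3"
    unfolding y by (simp add: derivs pderiv3_uminus, algebra)
  have zy: "pderiv3 3 (pderiv3 2 quartic_G) = - 6 * hvar 1 ^ 2 - 12 * hvar 1 * hvar 2
      - 12 * hvar 1 * hvar 3 + 9 * hvar 2 ^ 2"
    unfolding y by (simp add: derivs pderiv3_uminus, algebra)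
  have yz: "pderiv3 2 (pderiv3 3 quartic_G) = - 6 * hvar 1 ^ 2 - 12 * hvar 1 * hvar 2
      - 12 * hvar 1 * hvar 3 + 9 * hvar 2 ^ 2"
    unfolding z by (simp add: derivs, algebra)
  have zz: "pderiv3 3 (pderiv3 3 quartic_G) = 12 * hvar 1 ^ 2 - 12 * hvar 1 * hvar 2
      + 6 * hvar 1 * hvar 3"
    unfolding z by (simp add: derivs, algebra)
  show ?thesis unfolding minor_YZ_def yy zz yz zy D1_def
    by (simp add: algebra_simps power2_eq_square power3_eq_cube power4_eq_xxxx)
qed

lemma G0_eq: "G0 = hvar 1 * G1 + 3 * hvar 2 ^ 3 * (hvar 2 + hvar 3)"
  unfolding G0_def quartic_G_eq G1_def by (simp only: fiber0_hom)

lemma Q0_eq: "Q0 = hvar 1 * (12 * D1) - 972 * hvar 2 ^ 4"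
  unfolding Q0_def minor_YZ_quartic_G D1_def
  by (simp only: fiber0_hom) (simp add: algebra_simps)

lemma limit_flex_ideal_quartic_F:
  "limit_flex_ideal quartic_F = {a * hvar 1 ^ 4 + b * (hvar 1 ^ 2 * Q0) + c * P0 | a b c. True}"
proof -
  define x where "x = (hvar 1 :: complex poly poly3)"
  define Q where "Q = 12 * minor_YZ quartic_G"
  define E where "E = hessian quartic_G"
  define H where "H = x ^ 2 * Q + tvar * E"
  define P where "P = x ^ 2 * E - quartic_G * Q"
  let ?F = quartic_F and ?G = quartic_G
  have F: "?F = x ^ 4 + tvar * ?G" by (simp add: quartic_F_def x_def)
  have hess: "hessian ?F = tvar ^ 2 * H"
    unfolding quartic_F_def hessian_pencil H_def x_def Q_def E_def by (simp add: algebra_simps)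
  have fX: "fiber0 x = hvar 1" by (simp add: x_def fiber0_hom)
  have fQ: "fiber0 Q = Q0" by (simp add: Q_def Q0_def fiber0_hom)
  have fE: "fiber0 E = E0" by (simp add: E_def E0_def)
  have fF: "fiber0 ?F = hvar 1 ^ 4" by (rule fiber0_quartic_F)
  have fH: "fiber0 H = hvar 1 ^ 2 * Q0" by (simp add: H_def fiber0_hom fX fQ fiber0_tvar)
  have fP: "fiber0 P = P0" by (simp add: P_def P0_def G0_def fiber0_hom fX fQ fE)
  \<comment> \<open>Over t = 0 the terms X^2 (X^2 Q) and Q X^4 cancel, so the right-hand side is
    divisible by t; P is defined as the quotient.\<close>
  have TP: "tvar * P = x ^ 2 * H - Q * ?F"
    unfolding P_def H_def F by (simp add: algebra_simps power2_eq_square power4_eq_xxxx)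
  have syz: "x ^ 2 * P = E * ?F - ?G * H"
    unfolding P_def H_def F by (simp add: algebra_simps power2_eq_square power4_eq_xxxx)
  define J where "J = {a * ?F + b * H + c * P | a b c. True}"
  \<comment> \<open>At (0:1:0) the coordinate X vanishes, while \<open>G0\<close> and
    \<open>Q0\<close> take the values 3 and -972.\<close>
  have nG: "\<not> hvar 1 dvd G0" and nQ: "\<not> hvar 1 dvd Q0"
    using eval3_0_if_hvar_1_dvd[of G0 "axis 2 1"] eval3_0_if_hvar_1_dvd[of Q0 "axis 2 1"]
    by (auto simp: G0_eq Q0_eq eval3_hom axis_def)
  have cancel: "f = g" if "hvar 1 * f = hvar 1 * g" for f g :: "complex poly3"
    using that hvar_nonzero[of 1, where 'a = complex] by simp
  \<comment> \<open>P is -G Q modulo X, and the prime X divides neither G nor Q.\<close>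
  have nP: "hvar 1 dvd c" if "hvar 1 dvd c * P0" for c
  proof -
    have eq: "c * (G0 * Q0) = hvar 1 * (c * hvar 1 * E0) - c * P0"
      unfolding P0_def by (simp add: algebra_simps power2_eq_square)
    have "hvar 1 dvd c * (G0 * Q0)" unfolding eq using that by (intro dvd_diff dvd_triv_left)
    then show ?thesis using nG nQ unfolding hvar_1_dvd_mult_iff by blast
  qed
  \<comment> \<open>The basic syzygies are (-E0, G0, X^2) and (-Q0, X^2, 0), the fibers of
    \<open>syz\<close> and \<open>TP\<close>, taken with coefficients u and w. Divisibility by X is
    used four times: twice on c, which yields u, and twice on b - G0 u, which yields w.\<close>
  have fiber_syz: "\<exists>u w. c = hvar 1 ^ 2 * u \<and> b = G0 * u + hvar 1 ^ 2 * w \<and> a = - E0 * u - Q0 * w"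
    if eq: "a * hvar 1 ^ 4 + b * (hvar 1 ^ 2 * Q0) + c * P0 = 0" for a b c
  proof -
    let ?x = "hvar 1 :: complex poly3"
    have "c * P0 = ?x * (- (a * ?x ^ 3) - b * ?x * Q0)"
    proof -
      have "c * P0 = (a * ?x ^ 4 + b * (?x ^ 2 * Q0) + c * P0) - a * ?x ^ 4 - b * (?x ^ 2 * Q0)"
        by simp
      also have "\<dots> = ?x * (- (a * ?x ^ 3) - b * ?x * Q0)"
        unfolding eq by (simp add: algebra_simps power2_eq_square power3_eq_cube power4_eq_xxxx)
      finally show ?thesis .
    qed
    then obtain c1 where c1: "c = ?x * c1" using nP[of c] by (metis dvdE dvd_triv_left)
    have "?x * (c1 * P0) = ?x * (?x * (- (a * ?x ^ 2) - b * Q0))"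
      using \<open>c * P0 = _\<close> unfolding c1 by (simp add: algebra_simps power2_eq_square power3_eq_cube)
    then have c1P: "c1 * P0 = ?x * (- (a * ?x ^ 2) - b * Q0)" by (rule cancel)
    then obtain u where u: "c1 = ?x * u" using nP[of c1] by (metis dvdE dvd_triv_left)
    have "?x * (u * P0) = ?x * (- (a * ?x ^ 2) - b * Q0)"
      using c1P unfolding u by (simp add: mult.assoc)
    then have "u * P0 = - (a * ?x ^ 2) - b * Q0" by (rule cancel)
    then have bu: "(b - G0 * u) * Q0 = ?x * (?x * (- a - E0 * u))"
      unfolding P0_def by (simp add: algebra_simps power2_eq_square)
    then have "?x dvd (b - G0 * u) * Q0" by simp
    then obtain b1 where b1: "b - G0 * u = ?x * b1" using nQ unfolding hvar_1_dvd_mult_iff by (auto elim: dvdE)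
    have "?x * (b1 * Q0) = ?x * (?x * (- a - E0 * u))" using bu unfolding b1 by (simp add: mult.assoc)
    then have b1Q: "b1 * Q0 = ?x * (- a - E0 * u)" by (rule cancel)
    then have "?x dvd b1 * Q0" by simp
    then obtain w where w: "b1 = ?x * w" using nQ unfolding hvar_1_dvd_mult_iff by (auto elim: dvdE)
    have "?x * (w * Q0) = ?x * (- a - E0 * u)" using b1Q unfolding w by (simp add: mult.assoc)
    then have wQ: "w * Q0 = - a - E0 * u" by (rule cancel)
    have "a = - (- a - E0 * u) - E0 * u" by simp
    also have "\<dots> = - E0 * u - Q0 * w" unfolding wQ[symmetric] by (simp add: mult.commute)
    finally have "a = - E0 * u - Q0 * w" .
    moreover have "b = G0 * u + ?x ^ 2 * w"
      using b1 unfolding w by (simp add: algebra_simps power2_eq_square)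
    ultimately show ?thesis using c1 u by (auto simp: power2_eq_square mult.assoc)
  qed
  have J_saturated: "g \<in> J" if Tg: "tvar * g \<in> J" for g
  proof -
    obtain a b c where abc: "tvar * g = a * ?F + b * H + c * P" using Tg unfolding J_def by blast
    have "fiber0 (tvar * g) = fiber0 (a * ?F + b * H + c * P)" using abc by simp
    then have "fiber0 a * hvar 1 ^ 4 + fiber0 b * (hvar 1 ^ 2 * Q0) + fiber0 c * P0 = 0"
      by (simp add: fiber0_hom fF fH fP fiber0_tvar)
    then obtain u0 w0 where uw: "fiber0 c = hvar 1 ^ 2 * u0" "fiber0 b = G0 * u0 + hvar 1 ^ 2 * w0"
      "fiber0 a = - E0 * u0 - Q0 * w0"
      using fiber_syz by blast
    obtain u w where lift: "fiber0 u = u0" "fiber0 w = w0" using fiber0_surj by blast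
    have "fiber0 (a + E * u + Q * w) = 0" "fiber0 (b - ?G * u - x ^ 2 * w) = 0"
      "fiber0 (c - x ^ 2 * u) = 0"
      by (simp_all add: fiber0_hom fE fQ fX uw lift G0_def[symmetric])
    then obtain a' b' c' where red: "a + E * u + Q * w = tvar * a'" "b - ?G * u - x ^ 2 * w = tvar * b'"
      "c - x ^ 2 * u = tvar * c'"
      using fiber0_eq_0D by metis
    \<comment> \<open>After the lifted syzygies are subtracted, the remaining coefficients are
      divisible by t. The relation \<open>syz\<close> contributes 0, whereas \<open>TP\<close>
      contributes w t P; this is the source of the coefficient c' + w.\<close>
    have "tvar * g = (a + E * u + Q * w) * ?F + (b - ?G * u - x ^ 2 * w) * H + (c - x ^ 2 * u) * P
        + u * (x ^ 2 * P - (E * ?F - ?G * H)) + w * (x ^ 2 * H - Q * ?F)"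
      unfolding abc by (simp add: algebra_simps)
    also have "\<dots> = tvar * (a' * ?F + b' * H + (c' + w) * P)"
      unfolding red syz TP[symmetric] by (simp add: algebra_simps)
    finally have "g = a' * ?F + b' * H + (c' + w) * P" using tvar_nonzero by simp
    then show ?thesis unfolding J_def by blast
  qed
  have closure: "flex_ideal_closure ?F = J"
  proof (intro equalityI subsetI)
    fix g assume "g \<in> flex_ideal_closure ?F"
    then obtain k a b where "tvar ^ k * g = a * ?F + b * hessian ?F"
      unfolding flex_ideal_closure_iff flex_ideal_eq by blast
    then have "tvar ^ k * g = a * ?F + (b * tvar ^ 2) * H + 0 * P" by (simp add: hess mult.assoc)
    then have "tvar ^ k * g \<in> J" unfolding J_def by blast
    then show "g \<in> J"
    proof (induction k)
      case (Suc k)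
      then show ?case using J_saturated[of "tvar ^ k * g"] by (simp add: mult.assoc)
    qed simp
  next
    fix g assume "g \<in> J"
    then obtain a b c where "g = a * ?F + b * H + c * P" unfolding J_def by blast
    \<comment> \<open>The exponent 3 suffices for all generators: t^2 H is the Hessian, and t^3 P =
      X^2 (t^2 H) - t^2 Q F.\<close>
    then have "tvar ^ 3 * g = tvar ^ 3 * a * ?F + tvar * b * (tvar ^ 2 * H) + tvar ^ 2 * c * (tvar * P)"
      by (simp add: algebra_simps power2_eq_square power3_eq_cube)
    also have "\<dots> = (tvar ^ 3 * a - tvar ^ 2 * c * Q) * ?F + (tvar * b + c * x ^ 2) * hessian ?F"
      unfolding hess TP by (simp add: algebra_simps)
    finally show "g \<in> flex_ideal_closure ?F"
      unfolding flex_ideal_closure_iff flex_ideal_eq by blast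
  qed
  have image: "fiber0 ` J = {a * hvar 1 ^ 4 + b * (hvar 1 ^ 2 * Q0) + c * P0 | a b c. True}"
  proof (intro equalityI subsetI)
    fix f assume "f \<in> fiber0 ` J"
    then obtain a b c where "f = fiber0 (a * ?F + b * H + c * P)" unfolding J_def by blast
    then show "f \<in> {a * hvar 1 ^ 4 + b * (hvar 1 ^ 2 * Q0) + c * P0 | a b c. True}"
      by (auto simp: fiber0_hom fF fH fP)
  next
    fix f assume "f \<in> {a * hvar 1 ^ 4 + b * (hvar 1 ^ 2 * Q0) + c * P0 | a b c. True}"
    then obtain a b c where f: "f = a * hvar 1 ^ 4 + b * (hvar 1 ^ 2 * Q0) + c * P0" by blast
    obtain a' b' c' where "fiber0 a' = a" "fiber0 b' = b" "fiber0 c' = c" using fiber0_surj by metis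
    then have "f = fiber0 (a' * ?F + b' * H + c' * P)" by (simp add: fiber0_hom fF fH fP f)
    then show "f \<in> fiber0 ` J" unfolding J_def by blast
  qed
  interpret U: type_subring "UNIV :: complex poly3 set" by (rule type_subring_UNIV)
  let ?gs = "[hvar 1 ^ 4, hvar 1 ^ 2 * Q0, P0]"
  have idl: "U.idl ?gs = {a * hvar 1 ^ 4 + b * (hvar 1 ^ 2 * Q0) + c * P0 | a b c. True}"
    unfolding set_eq_iff U.idl3_iff by (simp add: add.assoc)
  have "genideal U.Rng (U.idl ?gs) = U.idl ?gs"
    by (intro equalityI U.genideal_superset U.genideal_subset_ideal U.is_ideal_idl) auto
  then show ?thesis
    unfolding limit_flex_ideal_def poly3_ring_UNIV closure image idl .
qed

section \<open>Degrees of the forms over t = 0\<close>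

lemma homogeneous3_fiber0: "homogeneous3 d f \<Longrightarrow> homogeneous3 d (fiber0 f)"
  unfolding homogeneous3_def fiber0_def by (auto simp: in_keys_iff lookup_map0)

lemma homogeneous3_G0: "homogeneous3 4 G0"
  unfolding G0_def by (intro homogeneous3_fiber0 homogeneous3_quartic_G)

lemma homogeneous3_Q0: "homogeneous3 4 Q0"
  unfolding Q0_def
  using homogeneous3_mult[OF homogeneous3_numeral homogeneous3_fiber0[OF homogeneous3_minor_YZ[of 2]]]
    homogeneous3_quartic_G
  by (simp add: numeral_eq_Suc)

lemma homogeneous3_E0: "homogeneous3 6 E0"
  unfolding E0_def
  using homogeneous3_fiber0[OF homogeneous3_hessian[of 2]] homogeneous3_quartic_G
  by (simp add: numeral_eq_Suc)

lemma homogeneous3_P0: "homogeneous3 8 P0"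
  unfolding P0_def
  by (intro homogeneous3_diff homogeneous3_mult'[OF homogeneous3_power'[OF homogeneous3_hvar] homogeneous3_E0]
      homogeneous3_mult'[OF homogeneous3_G0 homogeneous3_Q0]) simp_all

lemma homogeneous3_G1: "homogeneous3 3 (G1 :: 'a::comm_ring_1 poly3)"
  unfolding G1_def
  by (intro homogeneous3_add homogeneous3_diff;
      (rule homogeneous3_mult' homogeneous3_power' homogeneous3_numeral homogeneous3_hvar | simp)+)

lemma homogeneous3_D1: "homogeneous3 3 (12 * D1 :: 'a::comm_ring_1 poly3)"
proof -
  have "homogeneous3 3 (D1 :: 'a poly3)"
    unfolding D1_def
    by (intro homogeneous3_add homogeneous3_diff;
        (rule homogeneous3_mult' homogeneous3_power' homogeneous3_numeral homogeneous3_hvar | simp)+)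
  then show ?thesis using homogeneous3_mult[OF homogeneous3_numeral] by fastforce
qed

section \<open>Local rings of the plane\<close>

lemma (in type_subring) ring_length_Quot_self: "ring_length (Rng Quot R) = 0"
proof -
  have ideal_R: "is_ideal R" by (auto simp: is_ideal_def)
  have "n = 0" if chain: "ideal_chain n Rng R" for n
  proof (rule ccontr)
    assume "n \<noteq> 0"
    moreover obtain J where J: "\<And>i. i \<le> n \<Longrightarrow> is_ideal (J i) \<and> R \<subseteq> J i"
      "\<And>i. i < n \<Longrightarrow> J i \<subset> J (Suc i)"
      using chain unfolding ideal_chain_def ideal_Rng_iff by blast
    ultimately have "R \<subseteq> J 0" "J 0 \<subset> J 1" "J 1 \<subseteq> R"
      using is_idealD(1) J(1)[of 1] J(1)[of 0] J(2)[of 0] by auto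
    then show False by blast
  qed
  moreover have "ideal_chain 0 Rng R"
    unfolding ideal_chain_def ideal_Rng_iff using ideal_R by auto
  ultimately have "{n. ideal_chain n Rng R} = {0}" by blast
  moreover have "ideal R Rng" using ideal_R ideal_Rng_iff by simp
  ultimately show ?thesis by (simp add: ideal.ring_length_Quot zero_enat_def)
qed

lemma to_fract_numeral: "to_fract (numeral n :: 'a::idom) = numeral n"
proof -
  have "to_fract (of_nat k :: 'a) = of_nat k" for k by (induction k) simp_all
  from this[of "numeral n"] show ?thesis by simp
qed

lemma to_fract_power: "to_fract (a ^ n :: 'a::idom) = to_fract a ^ n"
  by (induction n) simp_all

lemmas to_fract_hom = to_fract_0 to_fract_1 to_fract_add to_fract_diff to_fract_uminus to_fract_mult
  to_fract_power to_fract_numeral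

lemma local_fractions_abs:
  assumes "v \<noteq> 0"
  shows "local_fractions I (abs_proj_plane v) =
    {to_fract f / to_fract g | f g d.
       f \<in> I \<and> homogeneous3 d f \<and> homogeneous3 d g \<and> eval3 v g \<noteq> 0}"
proof -
  have "proportional v v" using assms unfolding proportional_def by (auto intro: exI[of _ 1])
  then show ?thesis by (simp only: local_fractions.abs_eq Fract_conv_to_fract)
qed

locale plane_point =
  fixes v :: "complex ^ 3"
  assumes v_nonzero: "v \<noteq> 0"
begin

definition loc :: "complex poly3 set \<Rightarrow> complex poly3 fract set" where
  "loc I = {to_fract f / to_fract g | f g d.
     f \<in> I \<and> homogeneous3 d f \<and> homogeneous3 d g \<and> eval3 v g \<noteq> 0}"

lemma loc_eq: "local_fractions I (abs_proj_plane v) = loc I"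
  unfolding loc_def by (rule local_fractions_abs[OF v_nonzero])

lemma locI:
  "a = to_fract f / to_fract g \<Longrightarrow> f \<in> I \<Longrightarrow> homogeneous3 d f \<Longrightarrow> homogeneous3 d g \<Longrightarrow> eval3 v g \<noteq> 0
     \<Longrightarrow> a \<in> loc I"
  unfolding loc_def by blast

lemma locE:
  assumes "a \<in> loc I"
  obtains f g d where "a = to_fract f / to_fract g" "f \<in> I" "homogeneous3 d f" "homogeneous3 d g"
    "eval3 v g \<noteq> 0" "to_fract g \<noteq> 0"
proof -
  obtain f g d where *: "a = to_fract f / to_fract g" "f \<in> I" "homogeneous3 d f" "homogeneous3 d g"
    "eval3 v g \<noteq> 0"
    using assms unfolding loc_def by blast
  moreover have "to_fract g \<noteq> 0" using *(5) by (auto simp: eval3_zero)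
  ultimately show thesis using that by blast
qed

lemma loc_add:
  assumes I: "\<And>f g. f \<in> I \<Longrightarrow> g \<in> I \<Longrightarrow> f + g \<in> I" "\<And>f g. f \<in> I \<Longrightarrow> f * g \<in> I"
    and ab: "a \<in> loc I" "b \<in> loc I"
  shows "a + b \<in> loc I"
proof -
  obtain f g d where a: "a = to_fract f / to_fract g" "f \<in> I" "homogeneous3 d f" "homogeneous3 d g"
    "eval3 v g \<noteq> 0" "to_fract g \<noteq> 0"
    using ab(1) by (rule locE)
  obtain f' g' d' where b: "b = to_fract f' / to_fract g'" "f' \<in> I" "homogeneous3 d' f'"
    "homogeneous3 d' g'" "eval3 v g' \<noteq> 0" "to_fract g' \<noteq> 0"
    using ab(2) by (rule locE)
  show ?thesis
  proof (rule locI)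
    show "a + b = to_fract (f * g' + f' * g) / to_fract (g * g')"
      using a(1,6) b(1,6) by (simp add: add_frac_eq)
    show "homogeneous3 (d + d') (f * g' + f' * g)"
      using homogeneous3_mult[OF a(3) b(4)] homogeneous3_mult[OF b(3) a(4)]
      by (simp add: homogeneous3_add add.commute)
    show "homogeneous3 (d + d') (g * g')" by (rule homogeneous3_mult[OF a(4) b(4)])
  qed (use a b I in \<open>auto simp: eval3_mult\<close>)
qed

lemma loc_mult:
  assumes I: "\<And>f g. f \<in> I \<Longrightarrow> g * f \<in> I" and ab: "a \<in> loc UNIV" "b \<in> loc I"
  shows "a * b \<in> loc I"
proof -
  obtain f g d where a: "a = to_fract f / to_fract g" "homogeneous3 d f" "homogeneous3 d g"
    "eval3 v g \<noteq> 0"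
    using ab(1) by (rule locE)
  obtain f' g' d' where b: "b = to_fract f' / to_fract g'" "f' \<in> I" "homogeneous3 d' f'"
    "homogeneous3 d' g'" "eval3 v g' \<noteq> 0"
    using ab(2) by (rule locE)
  show ?thesis
    by (rule locI[of _ "f * f'" "g * g'" _ "d + d'"])
      (use a b I in \<open>auto simp: eval3_mult intro: homogeneous3_mult\<close>)
qed

sublocale type_subring "loc UNIV"
proof
  show "0 \<in> loc UNIV"
    by (rule locI[of _ 0 1 _ 0]) (auto simp: homogeneous3_zero homogeneous3_one eval3_one)
  show "1 \<in> loc UNIV"
    by (rule locI[of _ 1 1 _ 0]) (auto simp: homogeneous3_one eval3_one)
  show "- a \<in> loc UNIV" if "a \<in> loc UNIV" for a
    using that
  proof (rule locE)
    fix f g d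
    assume "a = to_fract f / to_fract g" "homogeneous3 d f" "homogeneous3 d g" "eval3 v g \<noteq> 0"
    then show ?thesis
      by (intro locI[of "- a" "- f" g _ d]) (auto intro: homogeneous3_uminus)
  qed
qed (auto intro: loc_add loc_mult)

lemma subscheme_local_ring_eq: "subscheme_local_ring I (abs_proj_plane v) = Rng Quot loc I"
  unfolding subscheme_local_ring_def local_ring_def loc_eq ..

lemma is_ideal_loc:
  assumes "0 \<in> I" "\<And>f g. f \<in> I \<Longrightarrow> g \<in> I \<Longrightarrow> f + g \<in> I" "\<And>f g. f \<in> I \<Longrightarrow> g * f \<in> I"
  shows "is_ideal (loc I)"
  unfolding is_ideal_def
proof (intro conjI ballI)
  show "loc I \<subseteq> loc UNIV" unfolding loc_def by blast
  show "0 \<in> loc I"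
    by (rule locI[of _ 0 1 _ 0]) (auto simp: assms homogeneous3_zero homogeneous3_one eval3_one)
  show "a + b \<in> loc I" if "a \<in> loc I" "b \<in> loc I" for a b
    using assms(2,3) that by (intro loc_add) (auto simp: mult.commute)
  show "r * a \<in> loc I" if "a \<in> loc I" "r \<in> loc UNIV" for a r
    using assms(3) that by (intro loc_mult)
qed

text \<open>A form of the ideal that does not vanish at v gives 1 = f/f in the localized ideal, so
  the quotient is the zero ring.\<close>

lemma ring_length_outside_support:
  assumes "0 \<in> I" "\<And>f g. f \<in> I \<Longrightarrow> g \<in> I \<Longrightarrow> f + g \<in> I" "\<And>f g. f \<in> I \<Longrightarrow> g * f \<in> I"
    and f: "f \<in> I" "homogeneous3 d f" "eval3 v f \<noteq> 0"
  shows "ring_length (subscheme_local_ring I (abs_proj_plane v)) = 0"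
proof -
  have ideal: "is_ideal (loc I)" using assms by (intro is_ideal_loc) blast+
  have "f \<noteq> 0" using f(3) by (auto simp: eval3_zero)
  then have "1 \<in> loc I" using f by (intro locI[of _ f f _ d]) auto
  then have "loc I = loc UNIV"
    using is_idealD(4)[OF ideal, of 1] is_idealD(1)[OF ideal] by auto
  then show ?thesis unfolding subscheme_local_ring_eq by (simp add: ring_length_Quot_self)
qed

text \<open>Passing to homogeneous components removes the need for homogeneous coefficients.\<close>

lemma hpart_mult_frac:
  assumes s: "homogeneous3 e s" and g: "homogeneous3 d g" "eval3 v g \<noteq> 0"
    and z: "homogeneous3 1 z" "z \<noteq> 0"
  shows "\<exists>r\<in>loc UNIV. to_fract (hpart d (a * s)) / to_fract g = r * (to_fract s / to_fract z ^ e)"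
proof (cases "e \<le> d")
  case True
  \<comment> \<open>The factor z^e restores the degree d lost by removing s, so that the quotient by
    g again has degree 0.\<close>
  let ?r = "to_fract (hpart (d - e) a * z ^ e) / to_fract g"
  have "homogeneous3 (d - e + e) (hpart (d - e) a * z ^ e)"
    using z(1) by (intro homogeneous3_mult homogeneous3_hpart homogeneous3_power') auto
  then have "?r \<in> loc UNIV" using True g by (intro locI[of _ _ g _ d]) auto
  moreover have "to_fract (hpart d (a * s)) / to_fract g = ?r * (to_fract s / to_fract z ^ e)"
    using True z(2) by (simp add: hpart_mult[OF s] to_fract_hom)
  ultimately show ?thesis by blast
next
  case False
  then show ?thesis by (intro bexI[of _ 0]) (simp_all add: hpart_mult[OF s])
qed

end

text \<open>Both points of the support lie on X = 0 outside Z = 0. The normalization Z = 1 makes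
  \<open>Yv\<close> a linear form through v, with second coordinate of v as its constant.\<close>

locale chart_point = plane_point +
  assumes v1: "v $ 1 = 0" and v3: "v $ 3 = 1"
begin

abbreviation "Yv \<equiv> hvar 2 - coeff_const (v $ 2) * hvar 3 :: complex poly3"

lemma homogeneous3_Yv: "homogeneous3 1 Yv"
  using homogeneous3_mult[OF homogeneous3_coeff_const homogeneous3_hvar, of "v $ 2" 3]
  by (intro homogeneous3_diff homogeneous3_hvar) simp

text \<open>Modulo X and \<open>Yv\<close> each variable is its value at v times Z, and such
  congruences are stable under products, and under sums in equal degree. The cofactors a and b need
  not be forms; their homogeneous parts are selected afterwards.\<close>

lemma residue_poly:
  assumes "homogeneous3 d h"
  shows "\<exists>a b. h = coeff_const (eval3 v h) * hvar 3 ^ d + (hvar 1 * a + Yv * b)"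
proof -
  define C where "C h d \<longleftrightarrow> (\<exists>a b. h = coeff_const (eval3 v h) * hvar 3 ^ d + (hvar 1 * a + Yv * b))"
    for h d
  have C_mult: "C (f * g) (d + e)" if fg: "C f d" "C g e" for f g d e
  proof -
    obtain a b a' b' where f: "f = coeff_const (eval3 v f) * hvar 3 ^ d + (hvar 1 * a + Yv * b)"
      and g: "g = coeff_const (eval3 v g) * hvar 3 ^ e + (hvar 1 * a' + Yv * b')"
      using fg unfolding C_def by blast
    let ?c = "coeff_const (eval3 v f) * hvar 3 ^ d" and ?c' = "coeff_const (eval3 v g) * hvar 3 ^ e"
    have "f * g = (?c + (hvar 1 * a + Yv * b)) * (?c' + (hvar 1 * a' + Yv * b'))"
      using f g by argo
    also have "\<dots> = ?c * ?c' + (hvar 1 * (a * ?c' + ?c * a' + a * (hvar 1 * a' + Yv * b'))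
        + Yv * (b * ?c' + ?c * b' + b * (hvar 1 * a' + Yv * b')))"
      by (simp only: distrib_left distrib_right add_ac mult_ac)
    also have "?c * ?c' = coeff_const (eval3 v (f * g)) * hvar 3 ^ (d + e)"
      by (simp add: eval3_mult coeff_const_mult power_add mult_ac)
    finally show ?thesis unfolding C_def by blast
  qed
  have C_add: "C (f + g) d" if fg: "C f d" "C g d" for f g d
  proof -
    obtain a b a' b' where f: "f = coeff_const (eval3 v f) * hvar 3 ^ d + (hvar 1 * a + Yv * b)"
      and g: "g = coeff_const (eval3 v g) * hvar 3 ^ d + (hvar 1 * a' + Yv * b')"
      using fg unfolding C_def by blast
    have cc: "coeff_const (s + t) = coeff_const s + (coeff_const t :: complex poly3)" for s t
      by (simp add: coeff_const_def single_add)
    have "f + g = (coeff_const (eval3 v f) * hvar 3 ^ d + (hvar 1 * a + Yv * b)) +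
        (coeff_const (eval3 v g) * hvar 3 ^ d + (hvar 1 * a' + Yv * b'))"
      using f g by argo
    also have "\<dots> = coeff_const (eval3 v (f + g)) * hvar 3 ^ d + (hvar 1 * (a + a') + Yv * (b + b'))"
      unfolding eval3_add cc by (simp only: distrib_left distrib_right add_ac mult_ac)
    finally show ?thesis unfolding C_def by blast
  qed
  have C_const: "C (coeff_const c) 0" for c
    unfolding C_def by (intro exI[of _ 0]) (simp add: eval3_coeff_const)
  have C_hvar: "C (hvar i) 1" for i
  proof -
    have "hvar 2 = coeff_const (eval3 v (hvar 2)) * hvar 3 ^ 1 + (hvar 1 * 0 + Yv * 1)"
      "hvar 1 = coeff_const (eval3 v (hvar 1)) * hvar 3 ^ 1 + (hvar 1 * 1 + Yv * 0)"
      "hvar 3 = coeff_const (eval3 v (hvar 3)) * hvar 3 ^ 1 + (hvar 1 * 0 + Yv * 0)"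
      by (simp_all add: eval3_hvar v1 v3)
    then show ?thesis using exhaust_3[of i] unfolding C_def by metis
  qed
  have C_power: "C (hvar i ^ n) n" for i n
  proof (induction n)
    case 0
    then show ?case using C_const[of 1] by simp
  next
    case (Suc n)
    then show ?case using C_mult[OF C_hvar Suc.IH] by simp
  qed
  have C_single: "C (Poly_Mapping.single m c) (mdeg m)" for m c
  proof -
    have "C (Poly_Mapping.single m c)
        (0 + Poly_Mapping.lookup m 1 + Poly_Mapping.lookup m 2 + Poly_Mapping.lookup m 3)"
      unfolding single_hvar_prod[of m c] by (intro C_mult C_const C_power)
    then show ?thesis by (simp add: sum_3)
  qed
  have "C (\<Sum>m\<in>S. Poly_Mapping.single m (Poly_Mapping.lookup h m)) d"
    if "finite S" "S \<subseteq> Poly_Mapping.keys h" for S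
    using that
  proof induction
    case empty
    show ?case unfolding C_def by (intro exI[of _ 0]) (simp add: eval3_zero)
  next
    case (insert m S)
    then have "mdeg m = d" using assms unfolding homogeneous3_def by blast
    then show ?case using insert C_single[of m] by (simp add: C_add)
  qed
  from this[of "Poly_Mapping.keys h"] show ?thesis
    unfolding C_def by (simp add: poly_mapping_sum_singles[symmetric])
qed

definition k :: "complex poly3 fract set" where
  "k = {to_fract (coeff_const c) | c. True}"

text \<open>\<open>x\<close> and \<open>y\<close> are the affine coordinates centred at v: X/Z, and
  Y/Z minus its value at v.\<close>

definition x :: "complex poly3 fract" where
  "x = to_fract (hvar 1) / to_fract (hvar 3)"

definition y :: "complex poly3 fract" where
  "y = to_fract Yv / to_fract (hvar 3)"

lemma Z_eval: "eval3 v (hvar 3) \<noteq> 0" "to_fract (hvar 3 :: complex poly3) \<noteq> 0"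
  using hvar_nonzero[of 3, where 'a = complex] by (simp_all add: eval3_hvar v3)

lemma form_in_loc: "homogeneous3 d f \<Longrightarrow> to_fract f / to_fract (hvar 3) ^ d \<in> loc UNIV"
  by (rule locI[of _ f "hvar 3 ^ d" _ d])
    (use Z_eval in \<open>auto simp: to_fract_hom eval3_hom intro!: homogeneous3_power' homogeneous3_hvar\<close>)

lemma unit_form:
  assumes "homogeneous3 d f" "eval3 v f \<noteq> 0"
  shows "inverse (to_fract f / to_fract (hvar 3) ^ d) \<in> loc UNIV"
  by (rule locI[of _ "hvar 3 ^ d" f _ d])
    (use assms in \<open>auto simp: to_fract_hom intro!: homogeneous3_power' homogeneous3_hvar\<close>)

text \<open>For a vanishing value, the constant term of \<open>residue_poly\<close> disappears.
  Taking the part of degree d turns the cofactors of X and \<open>Yv\<close> into fractions of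
  degree 0.\<close>

lemma vanishing_frac:
  assumes h: "homogeneous3 d h" "eval3 v h = 0" and g: "homogeneous3 d g" "eval3 v g \<noteq> 0"
  shows "\<exists>r\<in>loc UNIV. \<exists>s\<in>loc UNIV. to_fract h / to_fract g = x * r + y * s"
proof -
  obtain a b where ab: "h = hvar 1 * a + Yv * b" using residue_poly[OF h(1)] h(2) by auto
  have "h = hpart d (a * hvar 1 + b * Yv)"
    using hpart_homogeneous[OF h(1), of d] ab by (simp add: mult.commute)
  then have "to_fract h / to_fract g =
      to_fract (hpart d (a * hvar 1)) / to_fract g + to_fract (hpart d (b * Yv)) / to_fract g"
    by (simp add: hpart_add to_fract_hom add_divide_distrib)
  moreover obtain r where "r \<in> loc UNIV"
    "to_fract (hpart d (a * hvar 1)) / to_fract g = r * (to_fract (hvar 1) / to_fract (hvar 3) ^ 1)"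
    using hpart_mult_frac[OF homogeneous3_hvar g homogeneous3_hvar hvar_nonzero] by blast
  moreover obtain s where "s \<in> loc UNIV"
    "to_fract (hpart d (b * Yv)) / to_fract g = s * (to_fract Yv / to_fract (hvar 3) ^ 1)"
    using hpart_mult_frac[OF homogeneous3_Yv g homogeneous3_hvar hvar_nonzero] by blast
  ultimately show ?thesis
    by (intro bexI[of _ r] bexI[of _ s]) (simp_all only: x_def y_def power_one_right mult.commute)
qed

text \<open>Each axiom becomes a statement about forms: the residue of f/g is f(v)/g(v), a fraction
  is a unit when its numerator does not vanish at v, and regularity is primality of X.\<close>

sublocale regular_local2 "loc UNIV" k x y
proof
  have const: "to_fract (coeff_const c) \<in> loc UNIV" for c
    using form_in_loc[OF homogeneous3_coeff_const[of c]] by simp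
  then show "k \<subseteq> loc UNIV" unfolding k_def by blast
  show "inverse c \<in> k" if "c \<in> k" for c
  proof -
    obtain a where a: "c = to_fract (coeff_const a)" using \<open>c \<in> k\<close> unfolding k_def by blast
    have "inverse c = to_fract (coeff_const (inverse a))"
    proof (cases "a = 0")
      case False
      then have "c * to_fract (coeff_const (inverse a)) = 1"
        unfolding a by (simp flip: to_fract_mult coeff_const_mult)
      then show ?thesis by (simp add: inverse_unique)
    qed (simp add: a)
    then show ?thesis unfolding k_def by blast
  qed
  show "x \<in> loc UNIV" "y \<in> loc UNIV"
    using form_in_loc[OF homogeneous3_hvar[of 1]] form_in_loc[OF homogeneous3_Yv]
    by (simp_all add: x_def y_def)
  show "x \<noteq> 0"
    using hvar_nonzero[of 1, where 'a = complex] hvar_nonzero[of 3, where 'a = complex]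
    by (simp add: x_def)
  show "\<exists>c\<in>k. \<exists>b\<in>loc UNIV. \<exists>d\<in>loc UNIV. a = c + x * b + y * d" if a_loc: "a \<in> loc UNIV" for a
  proof -
    obtain f g d where a: "a = to_fract f / to_fract g" "homogeneous3 d f" "homogeneous3 d g"
      "eval3 v g \<noteq> 0" "to_fract g \<noteq> 0"
      using a_loc by (rule locE)
    define c where "c = eval3 v f / eval3 v g"
    let ?h = "f - coeff_const c * g"
    have "homogeneous3 d ?h"
      using homogeneous3_mult[OF homogeneous3_coeff_const[of c] a(3)] a(2)
      by (intro homogeneous3_diff) simp_all
    moreover have "eval3 v ?h = 0" using a(4) by (simp add: eval3_hom c_def)
    ultimately obtain r s where "r \<in> loc UNIV" "s \<in> loc UNIV" "to_fract ?h / to_fract g = x * r + y * s"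
      using vanishing_frac[OF _ _ a(3,4)] by blast
    moreover have "a = to_fract (coeff_const c) + to_fract ?h / to_fract g"
      using a(5) by (simp add: a(1) to_fract_hom diff_divide_distrib)
    ultimately show ?thesis unfolding k_def by (auto simp: add.assoc)
  qed
  show "inverse a \<in> loc UNIV \<or> (\<exists>b\<in>loc UNIV. \<exists>d\<in>loc UNIV. a = x * b + y * d)"
    if a_loc: "a \<in> loc UNIV" for a
  proof -
    obtain f g d where a: "a = to_fract f / to_fract g" "homogeneous3 d f" "homogeneous3 d g"
      "eval3 v g \<noteq> 0" "to_fract g \<noteq> 0"
      using a_loc by (rule locE)
    show ?thesis
    proof (cases "eval3 v f = 0")
      case True
      then show ?thesis using vanishing_frac[OF a(2) _ a(3,4)] a(1) by blast
    next
      case False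
      then show ?thesis using a by (intro disjI1 locI[of _ g f _ d]) auto
    qed
  qed
  \<comment> \<open>After clearing denominators, evaluation at v kills the left side, since X and
    \<open>Yv\<close> vanish there, but not Z g g'.\<close>
  show "x * b + y * d \<noteq> 1" if bd: "b \<in> loc UNIV" "d \<in> loc UNIV" for b d
  proof
    assume eq: "x * b + y * d = 1"
    obtain f g where b: "b = to_fract f / to_fract g" "eval3 v g \<noteq> 0" "to_fract g \<noteq> 0"
      using bd(1) by (rule locE)
    obtain f' g' where d: "d = to_fract f' / to_fract g'" "eval3 v g' \<noteq> 0" "to_fract g' \<noteq> 0"
      using bd(2) by (rule locE)
    have "to_fract (hvar 1 * f * g' + Yv * f' * g) = to_fract (hvar 3 * g * g')"
      using eq b(3) d(3) Z_eval(2) unfolding x_def y_def b(1) d(1)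
      by (simp add: to_fract_hom field_simps)
    then have "hvar 1 * f * g' + Yv * f' * g = hvar 3 * g * g'" by (simp only: to_fract_eq_iff)
    then have "eval3 v (hvar 1 * f * g' + Yv * f' * g) = eval3 v (hvar 3 * g * g')" by simp
    then show False using b(2) d(2) by (simp add: eval3_hom v1 v3)
  qed
  show "\<exists>c\<in>loc UNIV. b = x * c" if ab: "a \<in> loc UNIV" "b \<in> loc UNIV" and eq: "y * b = x * a" for a b
  proof -
    obtain f' g' where a: "a = to_fract f' / to_fract g'" "eval3 v g' \<noteq> 0" "to_fract g' \<noteq> 0"
      using ab(1) by (rule locE)
    obtain f g d where b: "b = to_fract f / to_fract g" "homogeneous3 d f" "homogeneous3 d g"
      "eval3 v g \<noteq> 0" "to_fract g \<noteq> 0"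
      using ab(2) by (rule locE)
    have cross: "p * (r * t') = q * (r' * t)" if "p / z * (r / t) = q / z * (r' / t')"
      "z \<noteq> 0" "t \<noteq> 0" "t' \<noteq> 0" for p q r r' t t' z :: "complex poly3 fract"
    proof -
      have "p * (r / t) = z * (p / z * (r / t))" using that(2) by simp
      also have "\<dots> = q * (r' / t')" unfolding that(1) using that(2) by simp
      finally have "p * (r / t) = q * (r' / t')" .
      then show ?thesis using that(3,4) by (simp add: field_simps)
    qed
    have "to_fract (Yv * (f * g')) = to_fract (hvar 1 * (f' * g))"
      using cross[OF eq[unfolded x_def y_def a(1) b(1)] Z_eval(2) b(5) a(3)]
      by (simp only: to_fract_mult)
    then have "hvar 1 dvd Yv * (f * g')" by (simp only: to_fract_eq_iff) simp
    \<comment> \<open>At (0:1:0) the form \<open>Yv\<close> takes the value 1 although X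
      vanishes.\<close>
    moreover have "\<not> hvar 1 dvd Yv"
      using eval3_0_if_hvar_1_dvd[of Yv "axis 2 1"] by (auto simp: eval3_hom axis_def)
    moreover have "\<not> hvar 1 dvd g'"
      using eval3_0_if_hvar_1_dvd[of g' v] a(2) v1 by auto
    ultimately have "hvar 1 dvd f" unfolding hvar_1_dvd_mult_iff by blast
    then obtain f1 where "f = f1 * hvar 1" by (auto simp: dvd_def mult.commute)
    then have "f = hpart d (f1 * hvar 1)" using hpart_homogeneous[OF b(2), of d] by simp
    then obtain r where "r \<in> loc UNIV" "b = r * (to_fract (hvar 1) / to_fract (hvar 3) ^ 1)"
      using hpart_mult_frac[OF homogeneous3_hvar b(3,4) homogeneous3_hvar hvar_nonzero] b(1) by metis
    then show ?thesis by (intro bexI[of _ r]) (simp_all add: x_def)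
  qed
qed

abbreviation dehom :: "complex poly3 \<Rightarrow> nat \<Rightarrow> complex poly3 fract" where
  "dehom f d \<equiv> to_fract f / to_fract (hvar 3) ^ d"

text \<open>Powers of Z are units at v, so dividing each generator by Z to its degree changes
  nothing in the local ring. The converse inclusion splits a form of the ideal into homogeneous
  parts.\<close>

lemma loc_three_generators:
  assumes s: "homogeneous3 e1 s1" "homogeneous3 e2 s2" "homogeneous3 e3 s3"
  shows "loc {a * s1 + b * s2 + c * s3 | a b c. True} = idl [dehom s1 e1, dehom s2 e2, dehom s3 e3]"
    (is "loc ?I = idl ?gs")
proof
  have gsR: "set ?gs \<subseteq> loc UNIV" using s form_in_loc by simp
  show "loc ?I \<subseteq> idl ?gs"
  proof
    fix u assume "u \<in> loc ?I"
    then obtain f g d where u: "u = to_fract f / to_fract g" "f \<in> ?I" "homogeneous3 d f"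
      "homogeneous3 d g" "eval3 v g \<noteq> 0"
      by (rule locE)
    from u(2) obtain a b c where f: "f = a * s1 + b * s2 + c * s3" by blast
    have "f = hpart d (a * s1 + b * s2 + c * s3)" using hpart_homogeneous[OF u(3), of d] f by simp
    then have "u = to_fract (hpart d (a * s1)) / to_fract g +
        (to_fract (hpart d (b * s2)) / to_fract g + to_fract (hpart d (c * s3)) / to_fract g)"
      unfolding u(1) by (simp add: hpart_add to_fract_hom add_divide_distrib)
    moreover note hpart_mult_frac[OF s(1) u(4,5) homogeneous3_hvar[of 3] hvar_nonzero, of a]
      hpart_mult_frac[OF s(2) u(4,5) homogeneous3_hvar[of 3] hvar_nonzero, of b]
      hpart_mult_frac[OF s(3) u(4,5) homogeneous3_hvar[of 3] hvar_nonzero, of c]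
    ultimately show "u \<in> idl ?gs" unfolding idl3_iff by metis
  qed
  have "0 \<in> ?I" by (auto intro!: exI[of _ 0])
  moreover have "f + g \<in> ?I" if "f \<in> ?I" "g \<in> ?I" for f g
  proof -
    from that obtain a b c a' b' c' where "f = a * s1 + b * s2 + c * s3"
      "g = a' * s1 + b' * s2 + c' * s3"
      by blast
    then have "f + g = (a + a') * s1 + (b + b') * s2 + (c + c') * s3" by (simp add: algebra_simps)
    then show ?thesis by blast
  qed
  moreover have "g * f \<in> ?I" if f: "f \<in> ?I" for f g
  proof -
    from f obtain a b c where "f = a * s1 + b * s2 + c * s3" by blast
    then have "g * f = (g * a) * s1 + (g * b) * s2 + (g * c) * s3" by (simp add: algebra_simps)
    then show ?thesis by blast
  qed
  ultimately have "is_ideal (loc ?I)" by (rule is_ideal_loc)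
  moreover have "set ?gs \<subseteq> loc ?I"
  proof -
    have gen: "dehom s' e \<in> loc ?I" if "s' \<in> ?I" "homogeneous3 e s'" for s' e
      by (rule locI[of _ s' "hvar 3 ^ e" _ e])
        (use that Z_eval in \<open>auto simp: to_fract_hom eval3_hom intro!: homogeneous3_power' homogeneous3_hvar\<close>)
    have "s1 = 1 * s1 + 0 * s2 + 0 * s3" "s2 = 0 * s1 + 1 * s2 + 0 * s3" "s3 = 0 * s1 + 0 * s2 + 1 * s3"
      by simp_all
    then have "s1 \<in> ?I" "s2 \<in> ?I" "s3 \<in> ?I" by blast+
    then show ?thesis using gen s by simp
  qed
  ultimately show "idl ?gs \<subseteq> loc ?I" by (rule idl_subset)
qed

text \<open>The forms in the first two hypotheses are what remains of \<open>P0\<close> and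
  \<open>Q0\<close> on X = 0: P0 becomes -G0 Q0 and 3 * 972 = 2916. Thus a and b are the vanishing
  orders of these restrictions at v, and r and s are the unit factors.\<close>

lemma ring_length_chart:
  assumes a: "dehom (2916 * hvar 2 ^ 7 * (hvar 2 + hvar 3)) 8 = r * y ^ a"
    and b: "dehom (- 972 * hvar 2 ^ 4) 4 = s * y ^ b"
    and rs: "r \<in> loc UNIV" "inverse r \<in> loc UNIV" "r \<noteq> 0" "s \<in> loc UNIV" "inverse s \<in> loc UNIV" "s \<noteq> 0"
    and "b \<le> a"
  shows "ring_length (subscheme_local_ring (limit_flex_ideal quartic_F) (abs_proj_plane v))
    = enat (2 * a + 2 * b)"
proof -
  let ?q = "dehom Q0 4" and ?p = "dehom P0 8" and ?g = "dehom G0 4" and ?h = "dehom E0 6"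
  let ?t = "dehom (12 * D1) 3" and ?g1 = "dehom G1 3"
  have X4: "homogeneous3 4 (hvar 1 ^ 4 :: complex poly3)"
    by (rule homogeneous3_power'[OF homogeneous3_hvar]) simp
  have X2Q: "homogeneous3 6 (hvar 1 ^ 2 * Q0)"
    by (rule homogeneous3_mult'[OF homogeneous3_power'[OF homogeneous3_hvar] homogeneous3_Q0]) simp_all
  have "loc (limit_flex_ideal quartic_F) = idl [dehom (hvar 1 ^ 4) 4, dehom (hvar 1 ^ 2 * Q0) 6, ?p]"
    unfolding limit_flex_ideal_quartic_F
    by (rule loc_three_generators[OF X4 X2Q homogeneous3_P0])
  also have "dehom (hvar 1 ^ 4) 4 = x ^ 4" by (simp add: x_def to_fract_hom power_divide)
  also have "dehom (hvar 1 ^ 2 * Q0) 6 = x ^ 2 * ?q"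
    by (simp add: x_def to_fract_hom power_divide flip: power_add)
  finally have loc: "loc (limit_flex_ideal quartic_F) = idl [x ^ 4, x ^ 2 * ?q, ?p]" .
  have q: "?q = s * y ^ b + x * ?t"
    unfolding b[symmetric] Q0_eq x_def using Z_eval(2)
    by (simp add: to_fract_hom field_simps power2_eq_square power3_eq_cube power4_eq_xxxx)
  have g: "?g = x * ?g1 + dehom (3 * hvar 2 ^ 3 * (hvar 2 + hvar 3)) 4"
    unfolding G0_eq x_def using Z_eval(2)
    by (simp add: to_fract_hom field_simps power2_eq_square power3_eq_cube power4_eq_xxxx)
  have p: "?p = x ^ 2 * ?h - ?g * ?q"
    unfolding P0_def x_def using Z_eval(2)
    by (simp add: to_fract_hom diff_divide_distrib power_divide flip: power_add)
  \<comment> \<open>\<open>w\<close> collects the terms divisible by x in P = x^2 E - G Q, after G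
    and Q are split into their restrictions to the line and multiples of x.\<close>
  define w where "w = x * ?h - ?g1 * ?q - dehom (3 * hvar 2 ^ 3 * (hvar 2 + hvar 3)) 4 * ?t"
  have "dehom (3 * hvar 2 ^ 3 * (hvar 2 + hvar 3)) 4 * (s * y ^ b) = - (r * y ^ a)"
    unfolding a[symmetric] b[symmetric] using Z_eval(2)
    by (simp add: to_fract_hom flip: power_add)
  moreover have "x ^ 2 * h - (x * g1 + C) * (B + x * t) = m + x * (x * h - g1 * (B + x * t) - C * t)"
    if "C * B = - m" for h g1 C B t m
    using that by (simp add: algebra_simps power2_eq_square)
  ultimately have p': "?p = r * y ^ a + x * w"
    unfolding p g w_def unfolding q by blast
  have "homogeneous3 4 (3 * hvar 2 ^ 3 * (hvar 2 + hvar 3) :: complex poly3)"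
    by (rule homogeneous3_mult' homogeneous3_power' homogeneous3_numeral homogeneous3_hvar
        homogeneous3_add | simp)+
  then have "w \<in> loc UNIV"
    unfolding w_def
    by (intro diff_closed mult_closed x_closed form_in_loc homogeneous3_E0 homogeneous3_G1
        homogeneous3_Q0 homogeneous3_D1)
  moreover have "?p = x ^ 2 * ?h + (- ?g) * ?q" using p by simp
  ultimately have "ring_length (Rng Quot idl [x ^ 4, x ^ 2 * ?q, ?p]) = enat (2 * a + 2 * b)"
    using p' q rs \<open>b \<le> a\<close>
    by (intro ring_length_quadruple_line[where u = r and w = w and v = s and s = ?t and g = "- ?g" and h = ?h]
        uminus_closed form_in_loc homogeneous3_E0 homogeneous3_G0 homogeneous3_D1)
  then show ?thesis unfolding subscheme_local_ring_eq loc .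
qed

end

section \<open>The limit cycle\<close>

lemma abs_proj_plane_eq_iff:
  assumes "u \<noteq> 0" "v \<noteq> 0"
  shows "abs_proj_plane u = abs_proj_plane v \<longleftrightarrow> proportional u v"
proof -
  have "proportional w w" if "w \<noteq> 0" for w
    using that unfolding proportional_def by (auto intro: exI[of _ 1])
  then show ?thesis using Quotient_rel[OF Quotient_proj_plane, of u v] assms by blast
qed

text \<open>As c is nonzero, the third coordinate determines the scalar as \<open>v $ 3 / c\<close>,
  and only the other two coordinates remain to be compared.\<close>

lemma hpoint_eq_abs_iff:
  assumes "v \<noteq> 0" "c \<noteq> 0"
  shows "hpoint a b c = abs_proj_plane v \<longleftrightarrow>
    v $ 3 \<noteq> 0 \<and> c * v $ 1 = a * v $ 3 \<and> c * v $ 2 = b * v $ 3"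
proof -
  have nz: "vector [a, b, c] \<noteq> (0 :: complex ^ 3)"
    using assms(2) by (metis vector_3(3) zero_index)
  have "hpoint a b c = abs_proj_plane v \<longleftrightarrow> (\<exists>r. v = r *s vector [a, b, c])"
    unfolding hpoint_def abs_proj_plane_eq_iff[OF nz assms(1)] proportional_def using nz assms(1) by simp
  also have "\<dots> \<longleftrightarrow> v $ 3 \<noteq> 0 \<and> c * v $ 1 = a * v $ 3 \<and> c * v $ 2 = b * v $ 3"
  proof
    assume "\<exists>r. v = r *s vector [a, b, c]"
    then obtain r where r: "v = r *s vector [a, b, c]" ..
    then have "r \<noteq> 0" using assms(1) by auto
    then show "v $ 3 \<noteq> 0 \<and> c * v $ 1 = a * v $ 3 \<and> c * v $ 2 = b * v $ 3"
      using assms(2) unfolding r by simp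
  next
    assume *: "v $ 3 \<noteq> 0 \<and> c * v $ 1 = a * v $ 3 \<and> c * v $ 2 = b * v $ 3"
    have "v = (v $ 3 / c) *s vector [a, b, c]"
      using * assms(2) by (simp add: vec_eq_iff forall_3 field_simps)
    then show "\<exists>r. v = r *s vector [a, b, c]" ..
  qed
  finally show ?thesis .
qed

lemma ring_length_hpoint_0_0_1:
  "ring_length (subscheme_local_ring (limit_flex_ideal quartic_F) (hpoint 0 0 1)) = 22"
proof -
  let ?v = "vector [0, 0, 1] :: complex ^ 3"
  interpret chart_point ?v
    by unfold_locales (simp_all, metis vector_3(3) zero_index zero_neq_one)
  \<comment> \<open>At (0:0:1) the local parameter is Y/Z and the factor Y + Z is a unit, so Y^7 and
    Y^4 give the orders 7 and 4.\<close>
  let ?u = "dehom (2916 * (hvar 2 + hvar 3)) 1" and ?s = "dehom (- 972) 0"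
  have u: "homogeneous3 1 (2916 * (hvar 2 + hvar 3) :: complex poly3)"
    by (rule homogeneous3_mult' homogeneous3_numeral homogeneous3_hvar homogeneous3_add | simp)+
  have s: "homogeneous3 0 (- 972 :: complex poly3)"
    by (intro homogeneous3_uminus homogeneous3_numeral)
  have eu: "eval3 ?v (2916 * (hvar 2 + hvar 3)) \<noteq> 0" and es: "eval3 ?v (- 972) \<noteq> 0"
    by (simp_all add: eval3_hom)
  have nz: "to_fract f \<noteq> 0" if "eval3 ?v f \<noteq> 0" for f
    using that by (auto simp: eval3_zero)
  have "y = dehom (hvar 2) 1" by (simp add: y_def)
  then have "dehom (2916 * hvar 2 ^ 7 * (hvar 2 + hvar 3)) 8 = ?u * y ^ 7"
    "dehom (- 972 * hvar 2 ^ 4) 4 = ?s * y ^ 4"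
    by (simp_all only: power_divide power_one_right power_0 div_by_1 to_fract_mult to_fract_power)
      (simp_all add: power_Suc[symmetric] eval_nat_numeral)
  then have "ring_length (subscheme_local_ring (limit_flex_ideal quartic_F) (abs_proj_plane ?v))
      = enat (2 * 7 + 2 * 4)"
    by (rule ring_length_chart[OF _ _ form_in_loc[OF u] unit_form[OF u eu] _ form_in_loc[OF s]
          unit_form[OF s es]])
      (use nz[OF eu] nz[OF es] Z_eval in simp_all)
  then show ?thesis by (simp add: hpoint_def numeral_eq_enat)
qed

lemma ring_length_hpoint_0_m1_1:
  "ring_length (subscheme_local_ring (limit_flex_ideal quartic_F) (hpoint 0 (- 1) 1)) = 2"
proof -
  let ?v = "vector [0, - 1, 1] :: complex ^ 3"
  interpret chart_point ?v
    by unfold_locales (simp_all, metis vector_3(3) zero_index zero_neq_one)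
  \<comment> \<open>At (0:-1:1) the roles are exchanged: y is (Y + Z)/Z and the powers of Y are
    units, so the orders are 1 and 0.\<close>
  let ?u = "dehom (2916 * hvar 2 ^ 7) 7" and ?s = "dehom (- 972 * hvar 2 ^ 4) 4"
  have u: "homogeneous3 7 (2916 * hvar 2 ^ 7 :: complex poly3)"
    by (rule homogeneous3_mult' homogeneous3_power' homogeneous3_numeral homogeneous3_hvar | simp)+
  have s: "homogeneous3 4 (- 972 * hvar 2 ^ 4 :: complex poly3)"
    by (rule homogeneous3_mult' homogeneous3_power' homogeneous3_numeral homogeneous3_uminus
        homogeneous3_hvar | simp)+
  have eu: "eval3 ?v (2916 * hvar 2 ^ 7) \<noteq> 0" and es: "eval3 ?v (- 972 * hvar 2 ^ 4) \<noteq> 0"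
    by (simp_all add: eval3_hom)
  have nz: "to_fract f \<noteq> 0" if "eval3 ?v f \<noteq> 0" for f
    using that by (auto simp: eval3_zero)
  have "coeff_const (- 1) = (- 1 :: complex poly3)"
    by (simp add: coeff_const_def single_uminus)
  then have "y = dehom (hvar 2 + hvar 3) 1" by (simp add: y_def)
  then have "dehom (2916 * hvar 2 ^ 7 * (hvar 2 + hvar 3)) 8 = ?u * y ^ 1"
    "dehom (- 972 * hvar 2 ^ 4) 4 = ?s * y ^ 0"
    by (simp_all only: power_one_right power_0 mult_1_right to_fract_mult)
      (simp add: power_Suc[symmetric] eval_nat_numeral)
  then have "ring_length (subscheme_local_ring (limit_flex_ideal quartic_F) (abs_proj_plane ?v))
      = enat (2 * 1 + 2 * 0)"
    by (rule ring_length_chart[OF _ _ form_in_loc[OF u] unit_form[OF u eu] _ form_in_loc[OF s]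
          unit_form[OF s es]])
      (use nz[OF eu] nz[OF es] Z_eval in simp_all)
  then show ?thesis by (simp add: hpoint_def numeral_eq_enat)
qed

text \<open>If X is nonzero at v, then X^4 gives a unit in the ideal. Otherwise P0 does, with value
  2916 Y^7 (Y + Z); this also covers (0:1:0), which lies outside the chart.\<close>

lemma ring_length_off_support:
  fixes v :: "complex ^ 3"
  assumes v: "v \<noteq> 0" and "v $ 1 \<noteq> 0 \<or> v $ 2 \<noteq> 0 \<and> v $ 2 + v $ 3 \<noteq> 0"
  shows "ring_length (subscheme_local_ring (limit_flex_ideal quartic_F) (abs_proj_plane v)) = 0"
proof -
  interpret plane_point v by unfold_locales (rule v)
  let ?I = "limit_flex_ideal quartic_F"
  have IE: "\<exists>a b c. f = a * hvar 1 ^ 4 + b * (hvar 1 ^ 2 * Q0) + c * P0" if "f \<in> ?I" for f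
    using that unfolding limit_flex_ideal_quartic_F by blast
  have II: "f \<in> ?I" if "f = a * hvar 1 ^ 4 + b * (hvar 1 ^ 2 * Q0) + c * P0" for f a b c
    using that unfolding limit_flex_ideal_quartic_F by blast
  have zero: "0 \<in> ?I" by (rule II[of _ 0 0 0]) simp
  have add: "f + g \<in> ?I" if fg: "f \<in> ?I" "g \<in> ?I" for f g
  proof -
    obtain a b c a' b' c' where "f = a * hvar 1 ^ 4 + b * (hvar 1 ^ 2 * Q0) + c * P0"
      "g = a' * hvar 1 ^ 4 + b' * (hvar 1 ^ 2 * Q0) + c' * P0"
      using IE[OF fg(1)] IE[OF fg(2)] by blast
    then show ?thesis by (intro II[of _ "a + a'" "b + b'" "c + c'"]) (simp add: algebra_simps)
  qed
  have mult: "g * f \<in> ?I" if f: "f \<in> ?I" for f g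
  proof -
    obtain a b c where "f = a * hvar 1 ^ 4 + b * (hvar 1 ^ 2 * Q0) + c * P0"
      using IE[OF f] by blast
    then show ?thesis by (intro II[of _ "g * a" "g * b" "g * c"]) (simp add: algebra_simps)
  qed
  show ?thesis
  proof (cases "v $ 1 = 0")
    case False
    have "hvar 1 ^ 4 \<in> ?I" by (rule II[of _ 1 0 0]) simp
    moreover have "homogeneous3 4 (hvar 1 ^ 4 :: complex poly3)"
      by (rule homogeneous3_power'[OF homogeneous3_hvar]) simp
    ultimately show ?thesis
      using False by (intro ring_length_outside_support[OF zero add mult]) (auto simp: eval3_hom)
  next
    case True
    have "P0 \<in> ?I" by (rule II[of _ 0 0 1]) simp
    moreover have "eval3 v P0 \<noteq> 0"
      using assms(2) True by (simp add: P0_def G0_eq Q0_eq eval3_hom)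
    ultimately show ?thesis
      using homogeneous3_P0 by (intro ring_length_outside_support[OF zero add mult])
  qed
qed

theorem theorem3p1:
  shows "has_zero_cycle (limit_flex_ideal quartic_F)
           (Poly_Mapping.single (hpoint 0 0 1) 22 + Poly_Mapping.single (hpoint 0 (-1) 1) 2)"
  unfolding has_zero_cycle_def
proof
  fix p :: proj_plane
  let ?C = "Poly_Mapping.single (hpoint 0 0 1) 22 + Poly_Mapping.single (hpoint 0 (-1) 1) (2 :: nat)"
  have distinct: "hpoint 0 0 1 \<noteq> hpoint 0 (- 1) 1"
  proof -
    have "vector [0, - 1, 1] \<noteq> (0 :: complex ^ 3)" by (metis vector_3(3) zero_index zero_neq_one)
    from hpoint_eq_abs_iff[OF this, of 1 0 0] show ?thesis unfolding hpoint_def by simp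
  qed
  obtain v where v: "v \<noteq> 0" "p = abs_proj_plane v"
    by (rule proj_plane.abs_induct[of "\<lambda>p. \<exists>v. v \<noteq> 0 \<and> p = abs_proj_plane v" p, THEN exE])
      (auto simp: proportional_def)
  note eq = hpoint_eq_abs_iff[OF v(1), of 1]
  consider "p = hpoint 0 0 1" | "p = hpoint 0 (- 1) 1"
    | "p \<noteq> hpoint 0 0 1" "p \<noteq> hpoint 0 (- 1) 1"
    by blast
  then show "ring_length (subscheme_local_ring (limit_flex_ideal quartic_F) p)
      = enat (Poly_Mapping.lookup ?C p)"
  proof cases
    case 1
    then show ?thesis
      using distinct ring_length_hpoint_0_0_1
      by (simp add: lookup_add lookup_single when_def numeral_eq_enat)
  next
    case 2
    then show ?thesis
      using distinct ring_length_hpoint_0_m1_1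
      by (simp add: lookup_add lookup_single when_def numeral_eq_enat)
  next
    case 3
    have "v $ 1 \<noteq> 0 \<or> v $ 2 \<noteq> 0 \<and> v $ 2 + v $ 3 \<noteq> 0"
    proof (rule ccontr)
      assume "\<not> ?thesis"
      then have v1: "v $ 1 = 0" and v23: "v $ 2 = 0 \<or> v $ 2 = - (v $ 3)"
        by (auto simp: eq_neg_iff_add_eq_0)
      \<comment> \<open>If Z vanished too, all coordinates would be zero; hence v can be scaled to
        third coordinate 1 and compared with the two points.\<close>
      have "v $ 3 \<noteq> 0"
      proof
        assume "v $ 3 = 0"
        with v1 v23 have "v = 0" by (auto simp: vec_eq_iff forall_3)
        with v(1) show False by simp
      qed
      with v1 v23 have "hpoint 0 0 1 = p \<or> hpoint 0 (- 1) 1 = p" unfolding v(2) by (auto simp: eq)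
      with 3 show False by auto
    qed
    then have "ring_length (subscheme_local_ring (limit_flex_ideal quartic_F) p) = 0"
      unfolding v(2) using v(1) by (intro ring_length_off_support)
    then show ?thesis
      using 3 by (simp add: lookup_add lookup_single when_def zero_enat_def)
  qed
qed

end
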